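(* Let $H$ be a stable subgroup of a Morse local-to-global group $G$. For any finite generating set $A$ of $G$, there exist polynomials $P(x),Q(x)\in\mathbb{Q}[x]$ such that $$\sum_{n=0}^\infty f_{H,A}(n)\,x^n=\frac{P(x)}{Q(x)},$$ where $f_{H,A}(n)$ is the number of elements of $H$ whose distance from the identity in the Cayley graph of $G$ with respect to $A$ is at most $n$.
   Context: All finite generating sets are symmetric ($A=A^{-1}$). $\mathrm{Cay}(G,A)$ is the Cayley graph (vertices $g\in G$, $g,h$ joined by an edge if $g^{-1}h\in A$, edges of length $1$), and $e$ is the identity. Morse quasi-geodesics: let $X$ be a metric space and $I\subseteq\mathbb{R}$ a closed interval. A map $\gamma:I\to X$ is a $(k,c)$-quasi-geodesic ($k\ge1$, $c\ge0$) if $\frac1k|s-t|-c\le d(\gamma(s),\gamma(t))\le k|s-t|+c$ for all $s,t\in I$; a geodesic is a $(1,0)$-quasi-geodesic. A Morse gauge is a function $M:[1,\infty)\times[0,\infty)\to[0,\infty)$. A quasi-geodesic $\gamma:I\to X$ is $M$-Morse if for every $[s,t]\subseteq I$, every $(k,c)$-quasi-geodesic with endpoints $\gamma(s),\gamma(t)$ is contained in the $M(k,c)$-neighborhood of $\gamma|_{[s,t]}$. An $(M;k,c)$-Morse quasi-geodesic is an $M$-Morse $(k,c)$-quasi-geodesic. For $B\ge0$, $\gamma:I\to X$ is a $(B;M;k,c)$-local Morse quasi-geodesic if $\gamma|_{[s,t]}$ is an $(M;k,c)$-Morse quasi-geodesic for every $[s,t]\subseteq I$ with $|s-t|\le B$.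 Morse local-to-global: $X$ is a Morse local-to-global space if for every Morse gauge $M$ and $k\ge1$, $c\ge0$ there exist $B\ge0$, a Morse gauge $M'$, and $k'\ge1$, $c'\ge0$ such that every $(B;M;k,c)$-local Morse quasi-geodesic is an $(M';k',c')$-Morse quasi-geodesic. A Morse local-to-global group is a finitely generated group some (equivalently, every) Cayley graph of which, with respect to a finite generating set, is a Morse local-to-global space. Stable subgroups: $H\le G$ is $(M,k)$-stable in $\mathrm{Cay}(G,A)$ if for every $h\in H$ every geodesic in $\mathrm{Cay}(G,A)$ from $e$ to $h$ is $M$-Morse and contained in the $k$-neighborhood of $H$. $H$ is stable if for every finite generating set $A$ of $G$ there exist $M$ and $k\ge0$ such that $H$ is $(M,k)$-stable in $\mathrm{Cay}(G,A)$. *)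

theory Defs
  imports
    "HOL-Analysis.Abstract_Metric_Spaces"
    "HOL-Algebra.Generated_Groups"
    "HOL-Computational_Algebra.Polynomial_FPS"
begin

subsection \<open>Morse quasi-geodesics in metric spaces\<close>

text \<open>Closed intervals may be bounded, half-infinite, all of \<open>\<real>\<close>, or a single point.\<close>

definition closed_interval :: "real set \<Rightarrow> bool" where
  "closed_interval I \<longleftrightarrow> I \<noteq> {} \<and> closed I \<and> is_interval I"

text \<open>Gauges are total functions; only their values on \<open>[1,\<infinity>) \<times> [0,\<infinity>)\<close> are ever used.\<close>

definition morse_gauge :: "(real \<Rightarrow> real \<Rightarrow> real) \<Rightarrow> bool" where
  "morse_gauge \<mu> \<longleftrightarrow> (\<forall>k\<ge>1. \<forall>c\<ge>0. \<mu> k c \<ge> 0)"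

context Metric_space
begin

definition quasi_geodesic :: "real \<Rightarrow> real \<Rightarrow> real set \<Rightarrow> (real \<Rightarrow> 'a) \<Rightarrow> bool" where
  "quasi_geodesic k c I \<gamma> \<longleftrightarrow>
     1 \<le> k \<and> 0 \<le> c \<and> closed_interval I \<and> \<gamma> \<in> I \<rightarrow> M \<and>
     (\<forall>s\<in>I. \<forall>t\<in>I. 1 / k * \<bar>s - t\<bar> - c \<le> d (\<gamma> s) (\<gamma> t) \<and> d (\<gamma> s) (\<gamma> t) \<le> k * \<bar>s - t\<bar> + c)"

abbreviation geodesic :: "real set \<Rightarrow> (real \<Rightarrow> 'a) \<Rightarrow> bool" where
  "geodesic \<equiv> quasi_geodesic 1 0"

definition neighborhood :: "real \<Rightarrow> 'a set \<Rightarrow> 'a set" where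
  "neighborhood r Y = (\<Union>y\<in>Y. mcball y r)"

definition is_morse :: "(real \<Rightarrow> real \<Rightarrow> real) \<Rightarrow> real set \<Rightarrow> (real \<Rightarrow> 'a) \<Rightarrow> bool" where
  "is_morse \<mu> I \<gamma> \<longleftrightarrow>
     (\<forall>s t. s \<le> t \<and> {s..t} \<subseteq> I \<longrightarrow>
       (\<forall>k c a b \<sigma>. a \<le> b \<and> quasi_geodesic k c {a..b} \<sigma> \<and> \<sigma> a = \<gamma> s \<and> \<sigma> b = \<gamma> t \<longrightarrow>
          \<sigma> ` {a..b} \<subseteq> neighborhood (\<mu> k c) (\<gamma> ` {s..t})))"

definition morse_quasi_geodesic ::
    "(real \<Rightarrow> real \<Rightarrow> real) \<Rightarrow> real \<Rightarrow> real \<Rightarrow> real set \<Rightarrow> (real \<Rightarrow> 'a) \<Rightarrow> bool" where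
  "morse_quasi_geodesic \<mu> k c I \<gamma> \<longleftrightarrow> quasi_geodesic k c I \<gamma> \<and> is_morse \<mu> I \<gamma>"

definition local_morse_quasi_geodesic ::
    "real \<Rightarrow> (real \<Rightarrow> real \<Rightarrow> real) \<Rightarrow> real \<Rightarrow> real \<Rightarrow> real set \<Rightarrow> (real \<Rightarrow> 'a) \<Rightarrow> bool" where
  "local_morse_quasi_geodesic B \<mu> k c I \<gamma> \<longleftrightarrow>
     closed_interval I \<and> \<gamma> \<in> I \<rightarrow> M \<and>
     (\<forall>s t. s \<le> t \<and> {s..t} \<subseteq> I \<and> \<bar>s - t\<bar> \<le> B \<longrightarrow> morse_quasi_geodesic \<mu> k c {s..t} \<gamma>)"

definition morse_local_to_global_space :: bool where
  "morse_local_to_global_space \<longleftrightarrow>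
     (\<forall>\<mu> k c. morse_gauge \<mu> \<and> 1 \<le> k \<and> 0 \<le> c \<longrightarrow>
       (\<exists>B \<mu>' k' c'. 0 \<le> B \<and> morse_gauge \<mu>' \<and> 1 \<le> k' \<and> 0 \<le> c' \<and>
          (\<forall>I \<gamma>. local_morse_quasi_geodesic B \<mu> k c I \<gamma> \<longrightarrow> morse_quasi_geodesic \<mu>' k' c' I \<gamma>)))"

end

subsection \<open>Graphs as metric spaces with edges of length 1\<close>

text \<open>
  A graph with vertex set \<open>V\<close> and symmetric edge relation \<open>E\<close> is realized geometrically by
  barycentric coordinates: \<open>edge_point u v t\<close> is the point at distance \<open>t\<close> from \<open>u\<close> on the edge
  between \<open>u\<close> and \<open>v\<close>. A loop \<open>(u, u)\<close> contributes only the point \<open>u\<close>, so a graph is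
  implicitly treated as simple.
\<close>

definition vertex :: "'v \<Rightarrow> 'v \<Rightarrow> real" where
  "vertex u = (\<lambda>x. of_bool (x = u))"

definition edge_point :: "'v \<Rightarrow> 'v \<Rightarrow> real \<Rightarrow> 'v \<Rightarrow> real" where
  "edge_point u v t = (\<lambda>x. (1 - t) * vertex u x + t * vertex v x)"

definition graph_points :: "'v set \<Rightarrow> ('v \<times> 'v) set \<Rightarrow> ('v \<Rightarrow> real) set" where
  "graph_points V E = vertex ` V \<union> (\<Union>(u, v)\<in>E. edge_point u v ` {0..1})"

text \<open>
  \<open>pl_path V E p q L\<close>: there is a piecewise linear path of length \<open>L\<close> from \<open>p\<close> to \<open>q\<close>, that is, a
  concatenation of finitely many linear segments, each contained in one edge.
\<close>

inductive pl_path :: "'v set \<Rightarrow> ('v \<times> 'v) set \<Rightarrow> ('v \<Rightarrow> real) \<Rightarrow> ('v \<Rightarrow> real) \<Rightarrow> real \<Rightarrow> bool"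
  for V E where
  refl: "p \<in> graph_points V E \<Longrightarrow> pl_path V E p p 0"
| step: "\<lbrakk>(u, v) \<in> E; s \<in> {0..1}; t \<in> {0..1}; pl_path V E (edge_point u v t) q L\<rbrakk>
         \<Longrightarrow> pl_path V E (edge_point u v s) q (\<bar>s - t\<bar> + L)"

text \<open>The value outside of the graph is a dummy, as required by \<^locale>\<open>Metric_space\<close>.\<close>

definition graph_dist :: "'v set \<Rightarrow> ('v \<times> 'v) set \<Rightarrow> ('v \<Rightarrow> real) \<Rightarrow> ('v \<Rightarrow> real) \<Rightarrow> real" where
  "graph_dist V E p q =
     (if p \<in> graph_points V E \<and> q \<in> graph_points V E then Inf {L. pl_path V E p q L} else 0)"

lemma edge_point_0 [simp]: "edge_point u v 0 = vertex u"
  and edge_point_1 [simp]: "edge_point u v 1 = vertex v"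
  by (simp_all add: edge_point_def)

lemma edge_point_flip: "edge_point v u (1 - t) = edge_point u v t"
  by (simp add: edge_point_def fun_eq_iff)

lemma edge_point_in_graph_points:
  "(u, v) \<in> E \<Longrightarrow> t \<in> {0..1} \<Longrightarrow> edge_point u v t \<in> graph_points V E"
  by (force simp: graph_points_def)

lemma pl_path_in_graph_points:
  "pl_path V E p q L \<Longrightarrow> p \<in> graph_points V E \<and> q \<in> graph_points V E \<and> 0 \<le> L"
  by (induction rule: pl_path.induct) (simp_all add: edge_point_in_graph_points)

lemma pl_path_trans: "pl_path V E p q L \<Longrightarrow> pl_path V E q r L' \<Longrightarrow> pl_path V E p r (L + L')"
proof (induction rule: pl_path.induct)
  case (step u v s t q L)
  then show ?case using pl_path.step[of u v E s t V r "L + L'"] by (simp add: add.assoc)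
qed simp

lemma pl_path_edge:
  assumes "(u, v) \<in> E" "s \<in> {0..1}" "t \<in> {0..1}"
  shows "pl_path V E (edge_point u v s) (edge_point u v t) \<bar>s - t\<bar>"
  using pl_path.step[OF assms pl_path.refl] assms by (simp add: edge_point_in_graph_points)

lemma pl_path_sym:
  assumes "pl_path V E p q L"
  shows "pl_path V E q p L"
  using assms
proof (induction rule: pl_path.induct)
  case (step u v s t q L)
  have "pl_path V E (edge_point u v t) (edge_point u v s) \<bar>t - s\<bar>"
    using step by (intro pl_path_edge) auto
  from pl_path_trans[OF step.IH this] show ?case
    by (simp add: abs_minus_commute add.commute)
qed (simp add: pl_path.refl)

text \<open>A function on vertices that varies by at most 1 along edges extends to a 1-Lipschitz function.\<close>

lemma pl_path_lipschitz:
  assumes F: "\<And>u v t. (u, v) \<in> E \<Longrightarrow> F (edge_point u v t) = (1 - t) * f u + t * (f v :: real)"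
    and f: "\<And>u v. (u, v) \<in> E \<Longrightarrow> \<bar>f u - f v\<bar> \<le> 1"
    and "pl_path V E p q L"
  shows "\<bar>F p - F q\<bar> \<le> L"
  using assms(3)
proof (induction rule: pl_path.induct)
  case (step u v s t q L)
  have "F (edge_point u v s) - F (edge_point u v t) = (s - t) * (f v - f u)"
    by (simp add: F[OF step(1)] algebra_simps)
  then have "\<bar>F (edge_point u v s) - F (edge_point u v t)\<bar> = \<bar>s - t\<bar> * \<bar>f u - f v\<bar>"
    by (simp add: abs_mult abs_minus_commute)
  also have "\<dots> \<le> \<bar>s - t\<bar>" using f[OF step(1)] by (simp add: mult_left_le)
  finally show ?case using step.IH by linarith
qed simp

lemma pl_path_vertices:
  assumes "(u, v) \<in> E ^^ n" "u \<in> V"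
  shows "pl_path V E (vertex u) (vertex v) (real n)"
  using assms(1)
proof (induction n arbitrary: v)
  case 0
  then show ?case using assms(2) by (auto intro!: pl_path.refl simp: graph_points_def)
next
  case (Suc n)
  then obtain w where "(u, w) \<in> E ^^ n" and w: "(w, v) \<in> E" by auto
  then have "pl_path V E (vertex u) (vertex w) (real n)" using Suc.IH by blast
  moreover have "pl_path V E (vertex w) (vertex v) 1"
    using pl_path_edge[OF w, of 0 1] by simp
  ultimately have "pl_path V E (vertex u) (vertex v) (real n + 1)" by (rule pl_path_trans)
  then show ?case by (simp add: add.commute)
qed

lemma vertex_inject [simp]: "vertex u = vertex v \<longleftrightarrow> u = v"
  by (auto simp: vertex_def fun_eq_iff)

lemma graph_dist_le: "pl_path V E p q L \<Longrightarrow> graph_dist V E p q \<le> L"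
  unfolding graph_dist_def
  by (auto dest: pl_path_in_graph_points intro!: cInf_lower bdd_belowI[of _ 0])

locale connected_graph =
  fixes V :: "'v set" and E :: "('v \<times> 'v) set"
  assumes edges: "E \<subseteq> V \<times> V"
    and connected: "u \<in> V \<Longrightarrow> v \<in> V \<Longrightarrow> (u, v) \<in> E\<^sup>*"
begin

lemma pl_path_to_vertex:
  assumes "p \<in> graph_points V E"
  shows "\<exists>u\<in>V. \<exists>L. pl_path V E p (vertex u) L"
proof -
  consider u where "u \<in> V" "p = vertex u"
    | u v t where "(u, v) \<in> E" "t \<in> {0..1}" "p = edge_point u v t"
    using assms by (auto simp: graph_points_def)
  then show ?thesis
  proof cases
    case 1
    then show ?thesis using assms pl_path.refl by blast
  next
    case 2
    then show ?thesis using edges pl_path_edge[of u v E t 0 V] by auto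
  qed
qed

lemma pl_path_exists:
  assumes "p \<in> graph_points V E" "q \<in> graph_points V E"
  shows "\<exists>L. pl_path V E p q L"
proof -
  obtain u L where u: "u \<in> V" "pl_path V E p (vertex u) L"
    using pl_path_to_vertex assms by blast
  obtain v L' where v: "v \<in> V" "pl_path V E q (vertex v) L'"
    using pl_path_to_vertex assms by blast
  obtain n where "(u, v) \<in> E ^^ n"
    using connected[OF u(1) v(1)] by (auto simp: rtrancl_power)
  then show ?thesis
    using pl_path_trans[OF u(2) pl_path_trans[OF pl_path_vertices[OF _ u(1)] pl_path_sym[OF v(2)]]]
    by blast
qed

lemma graph_dist_ge:
  assumes "p \<in> graph_points V E" "q \<in> graph_points V E" "\<And>L. pl_path V E p q L \<Longrightarrow> c \<le> L"
  shows "c \<le> graph_dist V E p q"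
  using assms pl_path_exists[OF assms(1,2)] by (auto simp: graph_dist_def intro!: cInf_greatest)

lemma Metric_space_graph: "Metric_space (graph_points V E) (graph_dist V E)"
proof
  fix p q r
  show nonneg: "0 \<le> graph_dist V E p q"
  proof (cases "p \<in> graph_points V E \<and> q \<in> graph_points V E")
    case True
    then show ?thesis using graph_dist_ge pl_path_in_graph_points by metis
  next
    case False
    then show ?thesis by (auto simp: graph_dist_def)
  qed
  have "{L. pl_path V E p q L} = {L. pl_path V E q p L}" using pl_path_sym by blast
  then show "graph_dist V E p q = graph_dist V E q p" by (simp add: graph_dist_def)
  assume p: "p \<in> graph_points V E" and q: "q \<in> graph_points V E"
  show "graph_dist V E p q = 0 \<longleftrightarrow> p = q"
  proof
    assume "p = q"
    then show "graph_dist V E p q = 0"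
      using nonneg graph_dist_le[OF pl_path.refl[OF p]] by simp
  next
    assume 0: "graph_dist V E p q = 0"
    show "p = q"
    proof
      fix x
      have "\<bar>p x - q x\<bar> \<le> L" if "pl_path V E p q L" for L
        by (rule pl_path_lipschitz[where F = "\<lambda>p. p x" and f = "\<lambda>u. vertex u x", OF _ _ that])
           (auto simp: edge_point_def vertex_def)
      then have "\<bar>p x - q x\<bar> \<le> graph_dist V E p q" by (rule graph_dist_ge[OF p q])
      with 0 show "p x = q x" by simp
    qed
  qed
  assume r: "r \<in> graph_points V E"
  have "graph_dist V E p r - L' \<le> graph_dist V E p q" if "pl_path V E q r L'" for L'
  proof (rule graph_dist_ge[OF p q])
    fix L assume "pl_path V E p q L"
    from graph_dist_le[OF pl_path_trans[OF this that]]
    show "graph_dist V E p r - L' \<le> L" by simp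
  qed
  then have "graph_dist V E p r - graph_dist V E p q \<le> graph_dist V E q r"
    by (intro graph_dist_ge[OF q r]) (simp add: algebra_simps)
  then show "graph_dist V E p r \<le> graph_dist V E p q + graph_dist V E q r" by simp
qed

lemma graph_dist_vertices:
  assumes sym: "sym E" and u: "u \<in> V" and v: "v \<in> V"
  shows "graph_dist V E (vertex u) (vertex v) = real (LEAST n. (u, v) \<in> E ^^ n)"
proof (rule antisym)
  define D where "D = (\<lambda>w. LEAST n. (u, w) \<in> E ^^ n)"
  have D: "(u, w) \<in> E ^^ D w" if "w \<in> V" for w
    unfolding D_def using connected[OF u that] by (auto simp: rtrancl_power intro: LeastI)
  have D_le: "D w' \<le> Suc (D w)" if e: "(w, w') \<in> E" for w w'
    unfolding D_def using D[unfolded D_def] e edges by (intro Least_le) auto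
  show "graph_dist V E (vertex u) (vertex v) \<le> real (LEAST n. (u, v) \<in> E ^^ n)"
    using graph_dist_le[OF pl_path_vertices[OF D[OF v] u]] by (simp add: D_def)
  define F where "F = (\<lambda>p :: 'v \<Rightarrow> real. \<Sum>x | p x \<noteq> 0. p x * real (D x))"
  have F_edge: "F (edge_point a b t) = (1 - t) * real (D a) + t * real (D b)" for a b t
  proof -
    have "F (edge_point a b t) = (\<Sum>x\<in>{a, b}. edge_point a b t x * real (D x))"
      unfolding F_def
      by (rule sum.mono_neutral_left) (auto simp: edge_point_def vertex_def split: if_splits)
    then show ?thesis
      by (cases "a = b") (auto simp: edge_point_def vertex_def algebra_simps)
  qed
  have F_vertex: "F (vertex a) = real (D a)" for a
    using F_edge[of a a 0] by simp
  have "D u = 0" unfolding D_def by (rule Least_eq_0) simp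
  moreover have "\<bar>F (vertex u) - F (vertex v)\<bar> \<le> graph_dist V E (vertex u) (vertex v)"
  proof (rule graph_dist_ge)
    fix L assume "pl_path V E (vertex u) (vertex v) L"
    then show "\<bar>F (vertex u) - F (vertex v)\<bar> \<le> L"
    proof (rule pl_path_lipschitz[OF F_edge, rotated])
      fix a b assume "(a, b) \<in> E"
      moreover have "(b, a) \<in> E" using sym \<open>(a, b) \<in> E\<close> by (rule symD)
      ultimately show "\<bar>real (D a) - real (D b)\<bar> \<le> 1"
        using D_le[of a b] D_le[of b a] by linarith
    qed
  qed (use u v in \<open>auto simp: graph_points_def\<close>)
  ultimately show "real (LEAST n. (u, v) \<in> E ^^ n) \<le> graph_dist V E (vertex u) (vertex v)"
    by (simp add: F_vertex D_def)
qed

end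

subsection \<open>Cayley graphs\<close>

definition finite_generating_set :: "('a, 'b) monoid_scheme \<Rightarrow> 'a set \<Rightarrow> bool" where
  "finite_generating_set G A \<longleftrightarrow>
     finite A \<and> A \<subseteq> carrier G \<and> A = m_inv G ` A \<and> generate G A = carrier G"

definition cayley_edges :: "('a, 'b) monoid_scheme \<Rightarrow> 'a set \<Rightarrow> ('a \<times> 'a) set" where
  "cayley_edges G A =
     {(g, h). g \<in> carrier G \<and> h \<in> carrier G \<and> inv\<^bsub>G\<^esub> g \<otimes>\<^bsub>G\<^esub> h \<in> A}"

definition cayley_points :: "('a, 'b) monoid_scheme \<Rightarrow> 'a set \<Rightarrow> ('a \<Rightarrow> real) set" where
  "cayley_points G A = graph_points (carrier G) (cayley_edges G A)"

definition cayley_dist ::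
    "('a, 'b) monoid_scheme \<Rightarrow> 'a set \<Rightarrow> ('a \<Rightarrow> real) \<Rightarrow> ('a \<Rightarrow> real) \<Rightarrow> real" where
  "cayley_dist G A = graph_dist (carrier G) (cayley_edges G A)"

lemma sym_cayley_edges:
  assumes "group G" "finite_generating_set G A"
  shows "sym (cayley_edges G A)"
proof (rule symI)
  interpret group G by fact
  fix g h assume "(g, h) \<in> cayley_edges G A"
  then have gh: "g \<in> carrier G" "h \<in> carrier G" "inv\<^bsub>G\<^esub> g \<otimes>\<^bsub>G\<^esub> h \<in> A"
    by (auto simp: cayley_edges_def)
  then have "inv\<^bsub>G\<^esub> (inv\<^bsub>G\<^esub> g \<otimes>\<^bsub>G\<^esub> h) \<in> A"
    using assms(2) by (auto simp: finite_generating_set_def)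
  then show "(h, g) \<in> cayley_edges G A"
    using gh by (simp add: cayley_edges_def inv_mult_group)
qed

lemma connected_cayley:
  assumes "group G" "finite_generating_set G A"
  shows "connected_graph (carrier G) (cayley_edges G A)"
proof
  interpret group G by fact
  have A: "A \<subseteq> carrier G" "\<And>a. a \<in> A \<Longrightarrow> inv\<^bsub>G\<^esub> a \<in> A" "generate G A = carrier G"
    using assms(2) by (auto simp: finite_generating_set_def)
  have edge: "(g, g \<otimes>\<^bsub>G\<^esub> a) \<in> cayley_edges G A" if "g \<in> carrier G" "a \<in> A" for g a
    using that A(1) by (auto simp: cayley_edges_def m_assoc[symmetric])
  have gen: "x \<in> generate G A \<Longrightarrow>
      \<forall>g\<in>carrier G. (g, g \<otimes>\<^bsub>G\<^esub> x) \<in> (cayley_edges G A)\<^sup>*" for x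
  proof (induction rule: generate.induct)
    case (eng x y)
    have "x \<in> carrier G" "y \<in> carrier G" using eng A(3) by auto
    then show ?case using eng.IH by (metis m_assoc m_closed rtrancl_trans)
  qed (use edge A(2) in auto)
  show "cayley_edges G A \<subseteq> carrier G \<times> carrier G" by (auto simp: cayley_edges_def)
  fix u v assume "u \<in> carrier G" "v \<in> carrier G"
  then show "(u, v) \<in> (cayley_edges G A)\<^sup>*"
    using gen[of "inv\<^bsub>G\<^esub> u \<otimes>\<^bsub>G\<^esub> v"] A(3) by (auto simp: m_assoc[symmetric])
qed

lemma Metric_space_cayley:
  "group G \<Longrightarrow> finite_generating_set G A \<Longrightarrow> Metric_space (cayley_points G A) (cayley_dist G A)"
  unfolding cayley_points_def cayley_dist_def
  by (intro connected_graph.Metric_space_graph connected_cayley)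

text \<open>On vertices the metric is the combinatorial distance, that is, the word metric.\<close>

lemma cayley_dist_vertices:
  "group G \<Longrightarrow> finite_generating_set G A \<Longrightarrow> g \<in> carrier G \<Longrightarrow> h \<in> carrier G \<Longrightarrow>
     cayley_dist G A (vertex g) (vertex h) = real (LEAST n. (g, h) \<in> cayley_edges G A ^^ n)"
  unfolding cayley_dist_def
  by (intro connected_graph.graph_dist_vertices connected_cayley sym_cayley_edges)

subsection \<open>Morse local-to-global groups, stable subgroups and growth\<close>

definition morse_local_to_global_group :: "('a, 'b) monoid_scheme \<Rightarrow> bool" where
  "morse_local_to_global_group G \<longleftrightarrow>
     group G \<and>
     (\<exists>A. finite_generating_set G A \<and>
          Metric_space.morse_local_to_global_space (cayley_points G A) (cayley_dist G A))"

definition stable_in_cayley ::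
    "('a, 'b) monoid_scheme \<Rightarrow> 'a set \<Rightarrow> (real \<Rightarrow> real \<Rightarrow> real) \<Rightarrow> real \<Rightarrow> 'a set \<Rightarrow> bool" where
  "stable_in_cayley G A \<mu> k H \<longleftrightarrow>
     (\<forall>h\<in>H. \<forall>a b \<gamma>.
        a \<le> b \<and> Metric_space.geodesic (cayley_points G A) (cayley_dist G A) {a..b} \<gamma> \<and>
        \<gamma> a = vertex \<one>\<^bsub>G\<^esub> \<and> \<gamma> b = vertex h \<longrightarrow>
        Metric_space.is_morse (cayley_points G A) (cayley_dist G A) \<mu> {a..b} \<gamma> \<and>
        \<gamma> ` {a..b} \<subseteq>
          Metric_space.neighborhood (cayley_points G A) (cayley_dist G A) k (vertex ` H))"

definition stable_subgroup :: "'a set \<Rightarrow> ('a, 'b) monoid_scheme \<Rightarrow> bool" where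
  "stable_subgroup H G \<longleftrightarrow>
     subgroup H G \<and>
     (\<forall>A. finite_generating_set G A \<longrightarrow>
        (\<exists>\<mu> k. morse_gauge \<mu> \<and> 0 \<le> k \<and> stable_in_cayley G A \<mu> k H))"

definition growth_function :: "('a, 'b) monoid_scheme \<Rightarrow> 'a set \<Rightarrow> 'a set \<Rightarrow> nat \<Rightarrow> nat" where
  "growth_function G H A n = card {h \<in> H. cayley_dist G A (vertex \<one>\<^bsub>G\<^esub>) (vertex h) \<le> real n}"

end

theory Submission
  imports Defs
begin

text \<open>
  The elements of \<open>H\<close> are counted by Cannon's method of cone types, restricted to the part of the
  Cayley graph that lies close to \<open>H\<close>.

  Give every nontrivial group element a parent one step closer to the identity, chosen by a rule
  that depends only on which generators shorten the element. This is a spanning tree, and the depth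
  of an element in it is its word length. For a vertex \<open>g\<close> let \<open>F\<^sub>g\<close> be the
  power series whose \<open>n\<close>-th coefficient counts the elements of \<open>H\<close> that lie \<open>n\<close> levels below
  \<open>g\<close>. Deleting the constant term of \<open>F\<^sub>g\<close> and dividing by the variable gives the sum of the
  series of the children of \<open>g\<close>. So if only finitely many different series occur, they span a
  finite-dimensional space that is closed under this shift; each of them then satisfies a linear
  recurrence and is rational (\<open>finite_shift_family_rational\<close>). The growth series of \<open>H\<close> is the
  series of the root divided by \<open>1 - x\<close>.

  Finiteness is where stability enters. If \<open>g\<close> has a descendant in \<open>H\<close>, then \<open>g\<close> lies on a geodesic
  from the identity to a point of \<open>H\<close>, hence in a fixed neighborhood \<open>S\<close> of \<open>H\<close>; otherwise the
  series vanishes. Next, if \<open>x\<close> is in \<open>S\<close> and \<open>h\<close> is a point of \<open>H\<close> near \<open>x\<close>, then a geodesic from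
  the identity to \<open>x\<close>, or to a point \<open>y\<close> near \<open>x\<close>, becomes a quasi-geodesic with fixed constants once
  it is prolonged to \<open>h\<close>. By the Morse property both stay close to one geodesic from
  the identity to \<open>h\<close>, and therefore to each other (\<open>nearby_geodesic_passes_close\<close>). Consequently, if \<open>g\<close>
  lies on a geodesic to \<open>x\<close>, then some geodesic to \<open>y\<close> passes through the ball of a fixed radius \<open>N\<close>
  around \<open>g\<close>, and the length of \<open>y\<close> relative to that of \<open>g\<close> can be read off from the relative
  lengths on that ball.

  Hence left multiplication by an element of \<open>H\<close> that preserves relative lengths on the ball
  around \<open>g\<close> also preserves, by induction down the tree, parents and levels of all descendants of
  \<open>g\<close> that lead to \<open>H\<close> (\<open>descendants_translate\<close>). So \<open>F\<^sub>g\<close> depends only on the relative lengths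
  on the ball of radius \<open>N\<close> and on the position of \<open>g\<close> relative to a nearby point of \<open>H\<close>, and for \<open>g\<close>
  in \<open>S\<close> there are finitely many possibilities for both.
\<close>

section \<open>Rationality from a finite set of power series closed under shifts\<close>

text \<open>
  The span of \<open>\<F>\<close> is a finite-dimensional space closed under the shift, so the iterated shifts of \<open>F\<close>
  are linearly dependent.
\<close>

lemma finite_shift_family_rational:
  fixes \<F> :: "'a::field fps set"
  assumes fin: "finite \<F>"
    and shift: "\<And>F. F \<in> \<F> \<Longrightarrow>
          \<exists>I c. finite I \<and> c ` I \<subseteq> \<F> \<and> fps_shift 1 F = (\<Sum>i\<in>(I :: 'i set). c i)"
    and F: "F \<in> \<F>"
  shows "\<exists>P Q. coeff Q 0 \<noteq> 0 \<and> F * fps_of_poly Q = fps_of_poly P"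
proof -
  interpret vector_space "\<lambda>(c::'a) (f::'a fps). fps_const c * f"
    by standard (auto simp: algebra_simps simp flip: fps_const_add fps_const_mult)
  \<comment> \<open>The shift is linear, so closure of the span can be checked on the generators.\<close>
  have span_shift: "fps_shift 1 f \<in> span \<F>" if "f \<in> span \<F>" for f
    using that
  proof (induction rule: span_induct_alt)
    case base
    then show ?case by (simp add: span_zero)
  next
    case (step c x y)
    obtain I s where "finite (I :: 'i set)" "s ` I \<subseteq> \<F>" "fps_shift 1 x = (\<Sum>i\<in>I. s i)"
      using shift[OF step(1)] by metis
    then have "fps_shift 1 x \<in> span \<F>" by (auto intro!: span_sum intro: span_base)
    moreover have "fps_shift 1 (fps_const c * x + y) = fps_const c * fps_shift 1 x + fps_shift 1 y"
      by (simp add: fps_eq_iff)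
    ultimately show ?case using step.IH by (simp add: span_add span_scale)
  qed
  have shifts: "fps_shift n F \<in> span \<F>" for n
  proof (induction n)
    case 0
    then show ?case using F by (simp add: span_base)
  next
    case (Suc n)
    moreover have "fps_shift (Suc n) F = fps_shift 1 (fps_shift n F)" by (simp add: fps_eq_iff)
    ultimately show ?case using span_shift by simp
  qed
  \<comment> \<open>A nontrivial linear relation between the shifts is a linear recurrence for the coefficients.\<close>
  have "\<exists>N c m. m \<le> N \<and> c m \<noteq> 0 \<and> (\<Sum>i\<le>N. fps_const (c i) * fps_shift i F) = 0"
  proof (cases "inj (\<lambda>n. fps_shift n F)")
    case False
    then obtain a b where "a \<noteq> b" "fps_shift a F = fps_shift b F" by (auto simp: inj_on_def)
    then obtain i j where ij: "i < j" "fps_shift i F = fps_shift j F"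
      by (cases "a < b") (use linorder_neqE_nat in metis)+
    define c where "c = (\<lambda>n. if n = i then 1 else if n = j then -1 else (0::'a))"
    have "(\<Sum>n\<le>j. fps_const (c n) * fps_shift n F) = (\<Sum>n\<in>{i,j}. fps_const (c n) * fps_shift n F)"
      using ij(1) by (intro sum.mono_neutral_right) (auto simp: c_def)
    also have "\<dots> = 0" using ij by (simp add: c_def)
    finally show ?thesis
      using ij(1) by (intro exI[of _ j] exI[of _ c]) (simp add: c_def)
  next
    case True
    define N where "N = card \<F>"
    let ?S = "(\<lambda>n. fps_shift n F) ` {..N}"
    have inj: "inj_on (\<lambda>n. fps_shift n F) {..N}" using True inj_on_subset by blast
    have "dependent ?S"
    proof (rule ccontr)
      assume "\<not> dependent ?S"
      moreover have "?S \<subseteq> span \<F>" using shifts by auto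
      ultimately have "card ?S \<le> card \<F>" using independent_span_bound[OF fin] by blast
      then show False using inj by (simp add: card_image N_def)
    qed
    moreover have "finite ?S" by simp
    ultimately obtain u v where u: "v \<in> ?S" "u v \<noteq> 0" "(\<Sum>v\<in>?S. fps_const (u v) * v) = 0"
      using dependent_finite by meson
    then obtain m where "m \<le> N" "u (fps_shift m F) \<noteq> 0" by auto
    moreover have "(\<Sum>n\<le>N. fps_const (u (fps_shift n F)) * fps_shift n F) = 0"
      using u(3) by (simp add: sum.reindex[OF inj])
    ultimately show ?thesis
      by (intro exI[of _ N] exI[of _ "\<lambda>n. u (fps_shift n F)"] exI[of _ m]) simp
  qed
  then obtain N c m0 where m0: "m0 \<le> N" "c m0 \<noteq> 0"
    and rel: "(\<Sum>i\<le>N. fps_const (c i) * fps_shift i F) = 0" by blast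
  \<comment> \<open>Reversing the recurrence at its top nonzero coefficient gives a denominator with nonzero
    constant term.\<close>
  define m where "m = Max {i. i \<le> N \<and> c i \<noteq> 0}"
  have "m \<in> {i. i \<le> N \<and> c i \<noteq> 0}" unfolding m_def using m0 by (intro Max_in) auto
  then have m: "m \<le> N" "c m \<noteq> 0" by auto
  have top: "c i = 0" if "i \<le> N" "m < i" for i
    using that Max_ge[of "{i. i \<le> N \<and> c i \<noteq> 0}" i] by (fastforce simp: m_def)
  define Q where "Q = (\<Sum>i\<le>m. monom (c i) (m - i))"
  have rec: "(\<Sum>i\<le>m. c i * fps_nth F (n + i)) = 0" for n
  proof -
    have "(\<Sum>i\<le>m. c i * fps_nth F (n + i)) = (\<Sum>i\<le>N. c i * fps_nth F (n + i))"
      using m top by (intro sum.mono_neutral_left) auto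
    also have "\<dots> = fps_nth (\<Sum>i\<le>N. fps_const (c i) * fps_shift i F) n"
      by (simp add: fps_sum_nth)
    finally show ?thesis using rel by simp
  qed
  have nth: "fps_nth (F * fps_of_poly Q) (n + m) = 0" for n
  proof -
    have "F * fps_of_poly Q = (\<Sum>i\<le>m. fps_const (c i) * (F * fps_X ^ (m - i)))"
      by (simp add: Q_def fps_of_poly_sum fps_of_poly_monom sum_distrib_left mult_ac)
    then have "fps_nth (F * fps_of_poly Q) (n + m) =
        (\<Sum>i\<le>m. c i * fps_nth (F * fps_X ^ (m - i)) (n + m))"
      by (simp add: fps_sum_nth)
    also have "\<dots> = (\<Sum>i\<le>m. c i * fps_nth F (n + i))"
      by (intro sum.cong) (auto simp: fps_X_power_mult_right_nth)
    finally show ?thesis using rec by simp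
  qed
  \<comment> \<open>Only the coefficients below \<open>m\<close> of the product survive, so it is a polynomial.\<close>
  define P where "P = (\<Sum>j<m. monom (fps_nth (F * fps_of_poly Q) j) j)"
  have "F * fps_of_poly Q = fps_of_poly P"
  proof (rule fps_ext)
    fix n
    show "fps_nth (F * fps_of_poly Q) n = fps_nth (fps_of_poly P) n"
      using nth[of "n - m"] by (cases "n < m") (auto simp: P_def coeff_sum)
  qed
  moreover have "coeff Q 0 = c m"
  proof -
    have "coeff Q 0 = (\<Sum>i\<le>m. if i = m then c i else 0)"
      unfolding Q_def coeff_sum by (intro sum.cong) auto
    then show ?thesis by simp
  qed
  ultimately show ?thesis using m(2) by metis
qed

section \<open>The word metric\<close>

lemma relpow_join_walk:
  assumes "(a, b) \<in> R ^^ m" "(b, c) \<in> R ^^ n"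
  shows "\<exists>f. f 0 = a \<and> f m = b \<and> f (m + n) = c \<and> (\<forall>i<m+n. (f i, f (Suc i)) \<in> R)"
proof -
  obtain f g where f: "f 0 = a" "f m = b" "\<forall>i<m. (f i, f (Suc i)) \<in> R"
    and g: "g 0 = b" "g n = c" "\<forall>i<n. (g i, g (Suc i)) \<in> R"
    using assms unfolding relpow_fun_conv by metis
  define q where "q = (\<lambda>i. if i \<le> m then f i else g (i - m))"
  have "(q i, q (Suc i)) \<in> R" if "i < m + n" for i
    using that f g unfolding q_def by (auto simp: Suc_diff_le le_less_Suc_eq not_less_eq_eq)
  moreover have "q 0 = a" "q m = b" "q (m + n) = c" using f g by (auto simp: q_def)
  ultimately show ?thesis by blast
qed

lemma walk_segment_relpow:
  assumes "\<forall>i<n. (f i, f (Suc i)) \<in> R" "i \<le> j" "j \<le> n"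
  shows "(f i, f j) \<in> R ^^ (j - i)"
  unfolding relpow_fun_conv using assms by (intro exI[of _ "\<lambda>k. f (i + k)"]) auto

lemma (in group) inv_mult_cancel:
  "c \<in> carrier G \<Longrightarrow> g \<in> carrier G \<Longrightarrow> inv c \<otimes> (c \<otimes> g) = g"
  "c \<in> carrier G \<Longrightarrow> g \<in> carrier G \<Longrightarrow> c \<otimes> (inv c \<otimes> g) = g"
  by (simp_all add: m_assoc[symmetric])

locale cayley_group = group G for G (structure) +
  fixes A :: "'a set"
  assumes gen: "finite_generating_set G A"
begin

abbreviation (input) "E \<equiv> cayley_edges G A"

definition wd :: "'a \<Rightarrow> 'a \<Rightarrow> nat" where
  "wd g h = (LEAST n. (g, h) \<in> E ^^ n)"

lemma
  finite_A: "finite A" and A_carrier: "A \<subseteq> carrier G"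
  using gen by (auto simp: finite_generating_set_def)

lemma edge_carrier: "(g, h) \<in> E \<Longrightarrow> g \<in> carrier G \<and> h \<in> carrier G"
  by (auto simp: cayley_edges_def)

lemma edge_mult: "g \<in> carrier G \<Longrightarrow> a \<in> A \<Longrightarrow> (g, g \<otimes> a) \<in> E"
  using A_carrier by (auto simp: cayley_edges_def m_assoc[symmetric])

lemma edge_translate: "(g, h) \<in> E \<Longrightarrow> c \<in> carrier G \<Longrightarrow> (c \<otimes> g, c \<otimes> h) \<in> E"
proof -
  assume a: "(g, h) \<in> E" "c \<in> carrier G"
  then have "g \<in> carrier G" "h \<in> carrier G" by (auto simp: cayley_edges_def)
  moreover have "inv (c \<otimes> g) \<otimes> (c \<otimes> h) = inv g \<otimes> h"
    using a calculation m_assoc[of "inv c" c h] by (simp add: inv_mult_group m_assoc)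
  ultimately show ?thesis using a by (auto simp: cayley_edges_def)
qed

lemma walk_carrier: "(g, h) \<in> E ^^ n \<Longrightarrow> g \<in> carrier G \<Longrightarrow> h \<in> carrier G"
  by (induction n arbitrary: h) (auto dest: edge_carrier)

lemma walk_translate:
  "(g, h) \<in> E ^^ n \<Longrightarrow> c \<in> carrier G \<Longrightarrow> (c \<otimes> g, c \<otimes> h) \<in> E ^^ n"
  by (induction n arbitrary: h) (auto dest: edge_translate)

lemma walk_sym: "(g, h) \<in> E ^^ n \<Longrightarrow> (h, g) \<in> E ^^ n"
proof (induction n arbitrary: h)
  case (Suc n)
  then obtain k where "(g, k) \<in> E ^^ n" "(k, h) \<in> E" by auto
  then have "(h, k) \<in> E" "(k, g) \<in> E ^^ n"
    using Suc.IH symD[OF sym_cayley_edges[OF is_group gen]] by auto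
  then show ?case by (rule relpow_Suc_I2)
qed auto

lemma walk_wd:
  assumes "g \<in> carrier G" "h \<in> carrier G"
  shows "(g, h) \<in> E ^^ wd g h"
proof -
  have "(g, h) \<in> E\<^sup>*"
    using connected_graph.connected[OF connected_cayley[OF is_group gen]] assms by blast
  then show ?thesis unfolding wd_def by (auto simp: rtrancl_power intro: LeastI)
qed

lemma wd_le: "(g, h) \<in> E ^^ n \<Longrightarrow> wd g h \<le> n"
  unfolding wd_def by (rule Least_le)

lemma wd_refl [simp]: "wd g g = 0"
  using wd_le[of g g 0] by simp

lemma wd_eq_0: "g \<in> carrier G \<Longrightarrow> h \<in> carrier G \<Longrightarrow> wd g h = 0 \<Longrightarrow> g = h"
  using walk_wd[of g h] by simp

lemma wd_triangle:
  "g \<in> carrier G \<Longrightarrow> h \<in> carrier G \<Longrightarrow> k \<in> carrier G \<Longrightarrow> wd g k \<le> wd g h + wd h k"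
  using walk_wd[of g h] walk_wd[of h k] by (intro wd_le) (auto simp: relpow_add)

lemma wd_sym: "g \<in> carrier G \<Longrightarrow> h \<in> carrier G \<Longrightarrow> wd g h = wd h g"
  by (intro antisym wd_le[OF walk_sym] walk_wd)

lemma wd_translate:
  assumes "g \<in> carrier G" "h \<in> carrier G" "c \<in> carrier G"
  shows "wd (c \<otimes> g) (c \<otimes> h) = wd g h"
proof (rule antisym)
  show "wd (c \<otimes> g) (c \<otimes> h) \<le> wd g h" using assms by (intro wd_le walk_translate walk_wd)
  have "(inv c \<otimes> (c \<otimes> g), inv c \<otimes> (c \<otimes> h)) \<in> E ^^ wd (c \<otimes> g) (c \<otimes> h)"
    using assms by (intro walk_translate walk_wd) auto
  then show "wd g h \<le> wd (c \<otimes> g) (c \<otimes> h)"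
    using assms by (intro wd_le) (simp add: m_assoc[symmetric])
qed

lemma wd_mult_generator: "g \<in> carrier G \<Longrightarrow> a \<in> A \<Longrightarrow> wd g (g \<otimes> a) \<le> 1"
  using edge_mult by (intro wd_le) auto

lemma wd_intermediate:
  assumes "g \<in> carrier G" "h \<in> carrier G" "i \<le> wd g h"
  shows "\<exists>p\<in>carrier G. wd g p = i \<and> wd p h = wd g h - i"
proof -
  have "(g, h) \<in> E ^^ i O E ^^ (wd g h - i)"
    using walk_wd[OF assms(1,2)] assms(3) by (simp flip: relpow_add)
  then obtain p where p: "(g, p) \<in> E ^^ i" "(p, h) \<in> E ^^ (wd g h - i)" by auto
  then have "p \<in> carrier G" using walk_carrier assms by blast
  with p[THEN wd_le] wd_triangle[of g p h] assms show ?thesis by force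
qed

lemma finite_ball:
  assumes "g \<in> carrier G"
  shows "finite {h \<in> carrier G. wd g h \<le> n}"
proof -
  have "finite {h. (g, h) \<in> E ^^ m}" for m
  proof (induction m)
    case (Suc m)
    have "{h. (g, h) \<in> E ^^ Suc m} \<subseteq> (\<Union>k\<in>{k. (g, k) \<in> E ^^ m}. (\<lambda>a. k \<otimes> a) ` A)"
    proof clarify
      fix h assume "(g, h) \<in> E ^^ Suc m"
      then obtain k where k: "(g, k) \<in> E ^^ m" "(k, h) \<in> E" by auto
      then have "h = k \<otimes> (inv k \<otimes> h)" "inv k \<otimes> h \<in> A"
        by (auto simp: cayley_edges_def m_assoc[symmetric])
      with k show "h \<in> (\<Union>k\<in>{k. (g, k) \<in> E ^^ m}. (\<lambda>a. k \<otimes> a) ` A)" by blast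
    qed
    moreover have "finite (\<Union>k\<in>{k. (g, k) \<in> E ^^ m}. (\<lambda>a. k \<otimes> a) ` A)"
      using Suc finite_A by blast
    ultimately show ?case by (rule finite_subset)
  qed simp
  then have "finite (\<Union>m\<le>n. {h. (g, h) \<in> E ^^ m})" by auto
  then show ?thesis by (rule finite_subset[rotated]) (use assms walk_wd in auto)
qed

end

section \<open>Discrete paths as quasi-geodesics of the Cayley graph\<close>

context cayley_group
begin

sublocale Cay: Metric_space "cayley_points G A" "cayley_dist G A"
  by (rule Metric_space_cayley[OF is_group gen])

lemma vertex_in_points [simp]: "g \<in> carrier G \<Longrightarrow> vertex g \<in> cayley_points G A"
  by (auto simp: cayley_points_def graph_points_def)

lemma cayley_dist_wd:
  "g \<in> carrier G \<Longrightarrow> h \<in> carrier G \<Longrightarrow> cayley_dist G A (vertex g) (vertex h) = real (wd g h)"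
  using cayley_dist_vertices[OF is_group gen] by (simp add: wd_def)

text \<open>
  At an integer time the position on the edge is \<open>0\<close>, so a walk of \<open>n\<close> steps determines the path
  up to and including time \<open>n\<close>.
\<close>

definition polygonal_path :: "(nat \<Rightarrow> 'a) \<Rightarrow> real \<Rightarrow> 'a \<Rightarrow> real" where
  "polygonal_path f s = edge_point (f (nat \<lfloor>s\<rfloor>)) (f (Suc (nat \<lfloor>s\<rfloor>))) (s - nat \<lfloor>s\<rfloor>)"

lemma polygonal_path_of_nat [simp]: "polygonal_path f (real i) = vertex (f i)"
  by (simp add: polygonal_path_def)

context
  fixes f :: "nat \<Rightarrow> 'a" and n :: nat
  assumes walk: "\<forall>i<n. (f i, f (Suc i)) \<in> E" and start: "f 0 \<in> carrier G"
begin

lemma walk_in_carrier: "i \<le> n \<Longrightarrow> f i \<in> carrier G"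
  using walk_segment_relpow[OF walk, of 0 i] walk_carrier start by auto

lemma wd_walk_le:
  assumes "i \<le> n" "j \<le> n"
  shows "real (wd (f i) (f j)) \<le> \<bar>real i - real j\<bar>"
proof -
  have *: "wd (f i) (f j) \<le> j - i" if "i \<le> j" "j \<le> n" for i j
    using wd_le[OF walk_segment_relpow[OF walk that]] .
  show ?thesis
  proof (cases "i \<le> j")
    case True
    then show ?thesis using *[OF True] assms by auto
  next
    case False
    then have "wd (f j) (f i) \<le> i - j" using * assms by auto
    then show ?thesis using wd_sym[of "f i" "f j"] walk_in_carrier assms False by auto
  qed
qed

lemma polygonal_path_in_points:
  assumes "0 \<le> s" "s \<le> real n"
  shows "polygonal_path f s \<in> cayley_points G A"
proof (cases "s = real n")
  case True
  then show ?thesis using walk_in_carrier by simp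
next
  case False
  then have "nat \<lfloor>s\<rfloor> < n" using assms by linarith
  moreover have "s - nat \<lfloor>s\<rfloor> \<in> {0..1}" using assms(1) by auto linarith+
  ultimately show ?thesis
    unfolding polygonal_path_def cayley_points_def using walk
    by (intro edge_point_in_graph_points) auto
qed

text \<open>
  A subpath consists of the rest of the first edge, a walk along whole edges, and the beginning of
  the last edge.
\<close>

lemma pl_path_polygonal_path:
  assumes "0 \<le> s" "s \<le> t" "t \<le> real n"
  shows "pl_path (carrier G) E (polygonal_path f s) (polygonal_path f t) (t - s)"
proof (cases "s = t")
  case True
  then show ?thesis
    using polygonal_path_in_points[of s] assms by (auto intro: pl_path.refl simp: cayley_points_def)
next
  case False
  define i j where "i = nat \<lfloor>s\<rfloor>" and "j = nat \<lfloor>t\<rfloor>"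
  have i: "real i \<le> s" "s < real i + 1" and j: "real j \<le> t" "t < real j + 1"
    using assms unfolding i_def j_def by linarith+
  have s: "polygonal_path f s = edge_point (f i) (f (Suc i)) (s - i)"
    and t: "polygonal_path f t = edge_point (f j) (f (Suc j)) (t - j)"
    by (simp_all add: polygonal_path_def i_def j_def)
  have "i < n" "i \<le> j" "j \<le> n" using i j assms False by linarith+
  show ?thesis
  proof (cases "i = j")
    case True
    have "pl_path (carrier G) E (edge_point (f i) (f (Suc i)) (s - i))
        (edge_point (f i) (f (Suc i)) (t - i)) \<bar>(s - i) - (t - i)\<bar>"
      using walk \<open>i < n\<close> i j True by (intro pl_path_edge) auto
    then show ?thesis using assms True by (simp add: s t)
  next
    case False
    then have "Suc i \<le> j" using \<open>i \<le> j\<close> by simp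
    have "pl_path (carrier G) E (edge_point (f i) (f (Suc i)) (s - i))
        (edge_point (f i) (f (Suc i)) 1) \<bar>(s - i) - 1\<bar>"
      using walk \<open>i < n\<close> i by (intro pl_path_edge) auto
    then have 1: "pl_path (carrier G) E (polygonal_path f s) (vertex (f (Suc i))) (i + 1 - s)"
      using i by (simp add: s abs_if algebra_simps)
    have 2: "pl_path (carrier G) E (vertex (f (Suc i))) (vertex (f j)) (real (j - Suc i))"
      using walk_segment_relpow[OF walk \<open>Suc i \<le> j\<close> \<open>j \<le> n\<close>] walk_in_carrier[of "Suc i"] \<open>i < n\<close>
      by (intro pl_path_vertices) auto
    have 3: "pl_path (carrier G) E (vertex (f j)) (polygonal_path f t) (t - j)"
    proof (cases "t = j")
      case True
      then show ?thesis
        using \<open>j \<le> n\<close> vertex_in_points[OF walk_in_carrier] pl_path.refl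
        by (auto simp: cayley_points_def)
    next
      case False
      then have "j < n" using j assms by linarith
      then have "pl_path (carrier G) E (edge_point (f j) (f (Suc j)) 0)
          (edge_point (f j) (f (Suc j)) (t - j)) \<bar>0 - (t - j)\<bar>"
        using walk j by (intro pl_path_edge) auto
      then show ?thesis using j by (simp add: t)
    qed
    have "i + 1 - s + (real (j - Suc i) + (t - j)) = t - s"
      using \<open>Suc i \<le> j\<close> by (simp add: of_nat_diff)
    then show ?thesis using pl_path_trans[OF 1 pl_path_trans[OF 2 3]] by simp
  qed
qed

text \<open>
  Only the upper bound on distances needs the geometry of the graph: if some pair of points were
  closer than its parameters, the path through them would be shorter than the distance of the ends.
\<close>

lemma polygonal_path_geodesic:
  assumes "wd (f 0) (f n) = n"
  shows "Cay.geodesic {0..real n} (polygonal_path f)"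
proof -
  let ?d = "\<lambda>s t. cayley_dist G A (polygonal_path f s) (polygonal_path f t)"
  have upper: "?d s t \<le> t - s" if "0 \<le> s" "s \<le> t" "t \<le> real n" for s t
    using graph_dist_le[OF pl_path_polygonal_path[OF that]] by (simp add: cayley_dist_def)
  have ends: "?d 0 (real n) = n"
    using polygonal_path_of_nat[of f 0] cayley_dist_wd[of "f 0" "f n"] walk_in_carrier assms by simp
  have eq: "?d s t = t - s" if "0 \<le> s" "s \<le> t" "t \<le> real n" for s t
  proof -
    have "?d 0 (real n) \<le> ?d 0 s + (?d s t + ?d t (real n))"
      using Cay.triangle[of "polygonal_path f 0" "polygonal_path f s" "polygonal_path f (real n)"]
        Cay.triangle[of "polygonal_path f s" "polygonal_path f t" "polygonal_path f (real n)"]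
        polygonal_path_in_points[of 0] polygonal_path_in_points[of s]
        polygonal_path_in_points[of t] polygonal_path_in_points[of n] that by simp
    then show ?thesis using upper[of 0 s] upper[of s t] upper[of t n] ends that by simp
  qed
  have "?d s t = \<bar>s - t\<bar>" if "s \<in> {0..real n}" "t \<in> {0..real n}" for s t
    using eq[of s t] eq[of t s] Cay.commute[of "polygonal_path f s" "polygonal_path f t"] that
    by (cases "s \<le> t") auto
  then show ?thesis
    using polygonal_path_in_points
    by (auto simp: Cay.quasi_geodesic_def closed_interval_def is_interval_1)
qed

text \<open>
  Quasi-geodesics need not be continuous, so a walk can be parametrized by jumping from vertex to
  vertex, which costs an additive \<open>1\<close>. A walk that exceeds the distance of its ends by \<open>C\<close> can lose
  at most \<open>C\<close> on any of its parts.
\<close>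

lemma step_path_quasi_geodesic:
  assumes "n \<le> wd (f 0) (f n) + C"
  shows "Cay.quasi_geodesic 1 (real C + 1) {0..real n} (\<lambda>s. vertex (f (nat \<lfloor>s\<rfloor>)))"
proof -
  have low: "real j - real i \<le> wd (f i) (f j) + C" if "i \<le> j" "j \<le> n" for i j
  proof -
    have "wd (f 0) (f n) \<le> wd (f 0) (f i) + (wd (f i) (f j) + wd (f j) (f n))"
      using wd_triangle[of "f 0" "f i" "f n"] wd_triangle[of "f i" "f j" "f n"]
        walk_in_carrier that by simp
    then show ?thesis
      using wd_walk_le[of 0 i] wd_walk_le[of j n] assms that by simp
  qed
  have low': "\<bar>real i - real j\<bar> \<le> wd (f i) (f j) + C" if "i \<le> n" "j \<le> n" for i j
    using low[of i j] low[of j i] wd_sym[of "f i" "f j"] walk_in_carrier that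
    by (cases "i \<le> j") auto
  have "1 / 1 * \<bar>s - t\<bar> - (real C + 1) \<le> cayley_dist G A (vertex (f (nat \<lfloor>s\<rfloor>))) (vertex (f (nat \<lfloor>t\<rfloor>))) \<and>
      cayley_dist G A (vertex (f (nat \<lfloor>s\<rfloor>))) (vertex (f (nat \<lfloor>t\<rfloor>))) \<le> 1 * \<bar>s - t\<bar> + (real C + 1)"
    if "s \<in> {0..real n}" "t \<in> {0..real n}" for s t
  proof -
    define i j where "i = nat \<lfloor>s\<rfloor>" and "j = nat \<lfloor>t\<rfloor>"
    have b: "real i \<le> s" "s < real i + 1" "real j \<le> t" "t < real j + 1"
      using that unfolding i_def j_def atLeastAtMost_iff by linarith+
    then have ij: "i \<le> n" "j \<le> n" using that by auto
    have "\<bar>\<bar>s - t\<bar> - \<bar>real i - real j\<bar>\<bar> \<le> 1" using b by linarith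
    then show ?thesis
      using low'[OF ij] wd_walk_le[OF ij] cayley_dist_wd[of "f i" "f j"] walk_in_carrier ij
      unfolding i_def[symmetric] j_def[symmetric] by (simp; linarith)
  qed
  moreover have "vertex (f (nat \<lfloor>s\<rfloor>)) \<in> cayley_points G A" if "s \<in> {0..real n}" for s
    using that by (intro vertex_in_points walk_in_carrier) (auto simp: nat_le_iff floor_le_iff)
  ultimately show ?thesis
    unfolding Cay.quasi_geodesic_def by (auto simp: closed_interval_def is_interval_1)
qed

end

end

section \<open>Geodesics near a stable subgroup fellow-travel\<close>

context cayley_group
begin

text \<open>
  The point \<open>p\<close> lies on some geodesic from the identity to \<open>x\<close>.
\<close>

definition on_geodesic :: "'a \<Rightarrow> 'a \<Rightarrow> bool" where
  "on_geodesic p x \<longleftrightarrow> p \<in> carrier G \<and> x \<in> carrier G \<and> wd \<one> p + wd p x = wd \<one> x"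

lemma geodesic_walk_through:
  assumes "on_geodesic p x"
  obtains f where "f 0 = \<one>" "f (wd \<one> p) = p" "f (wd \<one> x) = x"
    "\<forall>i<wd \<one> x. (f i, f (Suc i)) \<in> E"
  using relpow_join_walk[OF walk_wd[of \<one> p] walk_wd[of p x]] assms
  by (auto simp: on_geodesic_def)

end

locale stable_in_cayley_group = cayley_group +
  fixes H \<mu> k
  assumes subgroup_H: "subgroup H G" and stable: "stable_in_cayley G A \<mu> k H"
begin

lemma H_carrier: "h \<in> H \<Longrightarrow> h \<in> carrier G"
  using subgroup.subset[OF subgroup_H] by auto

text \<open>
  The conditions of stability, which concern geodesics in the geometric realization, for
  geodesics given as walks in the group.
\<close>

lemma stableD:
  assumes "h \<in> H" "\<forall>i<wd \<one> h. (f i, f (Suc i)) \<in> E" "f 0 = \<one>" "f (wd \<one> h) = h"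
  shows "Cay.is_morse \<mu> {0..real (wd \<one> h)} (polygonal_path f)"
    and "polygonal_path f ` {0..real (wd \<one> h)} \<subseteq> Cay.neighborhood k (vertex ` H)"
proof -
  have "Cay.geodesic {0..real (wd \<one> h)} (polygonal_path f)"
    using assms by (intro polygonal_path_geodesic) auto
  moreover have "polygonal_path f 0 = vertex \<one>" "polygonal_path f (wd \<one> h) = vertex h"
    using polygonal_path_of_nat[of f 0] assms by simp_all
  ultimately show "Cay.is_morse \<mu> {0..real (wd \<one> h)} (polygonal_path f)"
    and "polygonal_path f ` {0..real (wd \<one> h)} \<subseteq> Cay.neighborhood k (vertex ` H)"
    using stable \<open>h \<in> H\<close> unfolding stable_in_cayley_def
    by (meson of_nat_0_le_iff)+
qed

definition near_H :: "'a set" where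
  "near_H = {g \<in> carrier G. \<exists>h\<in>H. wd g h \<le> nat \<lceil>k\<rceil>}"

lemma on_geodesic_near_H:
  assumes "h \<in> H" "on_geodesic p h"
  shows "p \<in> near_H"
proof -
  obtain f where f: "f 0 = \<one>" "f (wd \<one> p) = p" "f (wd \<one> h) = h"
    "\<forall>i<wd \<one> h. (f i, f (Suc i)) \<in> E"
    using geodesic_walk_through[OF assms(2)] .
  have "real (wd \<one> p) \<in> {0..real (wd \<one> h)}" using assms(2) by (auto simp: on_geodesic_def)
  then have "polygonal_path f (real (wd \<one> p)) \<in> Cay.neighborhood k (vertex ` H)"
    using stableD(2)[OF assms(1) f(4,1,3)] by blast
  then have "vertex p \<in> Cay.neighborhood k (vertex ` H)" by (simp add: f(2))
  then obtain h' where "h' \<in> H" "cayley_dist G A (vertex h') (vertex p) \<le> k"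
    by (auto simp: Cay.neighborhood_def)
  then have "h' \<in> H" "wd p h' \<le> nat \<lceil>k\<rceil>"
    using assms(2) H_carrier[of h'] cayley_dist_wd[of h' p] wd_sym[of p h']
    by (auto simp: on_geodesic_def) linarith
  then show ?thesis using assms(2) by (auto simp: near_H_def on_geodesic_def)
qed

text \<open>
  For \<open>y\<close> at distance at most \<open>C\<close> from \<open>h\<close>, a geodesic to \<open>y\<close> prolonged by a geodesic from \<open>y\<close> to
  \<open>h\<close> is a quasi-geodesic whose constants depend only on \<open>C\<close>. The Morse property puts every point
  of it close to some point of a geodesic \<open>f\<close> to \<open>h\<close>; comparing distances to the identity shows that
  this point can be taken at the same level. The level is cut off at the length of \<open>h\<close>, since
  \<open>y\<close> can be farther from the identity than \<open>h\<close>.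
\<close>

lemma fellow_traveling:
  "\<exists>r. \<forall>h\<in>H. \<exists>f. f ` {..wd \<one> h} \<subseteq> carrier G \<and>
      (\<forall>i\<le>wd \<one> h. \<forall>j\<le>wd \<one> h. real (wd (f i) (f j)) \<le> \<bar>real i - real j\<bar>) \<and>
      (\<forall>y p. on_geodesic p y \<longrightarrow> wd y h \<le> C \<longrightarrow> wd p (f (min (wd \<one> p) (wd \<one> h))) \<le> r)"
proof -
  define R where "R = nat \<lceil>\<mu> 1 (real (2 * C) + 1)\<rceil>"
  have R: "\<mu> 1 (real (2 * C) + 1) \<le> real R" unfolding R_def by linarith
  have "wd p (f (min (wd \<one> p) (wd \<one> h))) \<le> 2 * (R + 1)"
    if h: "h \<in> H" and f: "f 0 = \<one>" "f (wd \<one> h) = h" "\<forall>i<wd \<one> h. (f i, f (Suc i)) \<in> E"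
      and py: "on_geodesic p y" and y: "wd y h \<le> C" for h f y p
  proof -
    let ?n = "wd \<one> h"
    define m where "m = wd \<one> p + (wd p y + wd y h)"
    have carr: "p \<in> carrier G" "y \<in> carrier G" "h \<in> carrier G"
      using py H_carrier h by (auto simp: on_geodesic_def)
    have fc: "f i \<in> carrier G" if "i \<le> ?n" for i using walk_in_carrier[OF f(3)] f(1) that by simp
    have fw: "real (wd (f i) (f j)) \<le> \<bar>real i - real j\<bar>" if "i \<le> ?n" "j \<le> ?n" for i j
      using wd_walk_le[OF f(3)] f(1) that by simp
    \<comment> \<open>The detour through \<open>p\<close> and \<open>y\<close> is longer than the geodesic by at most \<open>2 * C\<close>.\<close>
    have "(p, h) \<in> E ^^ (wd p y + wd y h)"
      using walk_wd carr by (auto simp: relpow_add)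
    then obtain q where q: "q 0 = \<one>" "q (wd \<one> p) = p" "q m = h" "\<forall>i<m. (q i, q (Suc i)) \<in> E"
      using relpow_join_walk[OF walk_wd[of \<one> p]] carr unfolding m_def by fastforce
    have "wd \<one> y \<le> ?n + C"
      using wd_triangle[of \<one> h y] wd_sym[of h y] carr y by simp
    then have "m \<le> wd (q 0) (q m) + 2 * C" using py y q by (simp add: m_def on_geodesic_def)
    then have "Cay.quasi_geodesic 1 (real (2 * C) + 1) {0..real m} (\<lambda>s. vertex (q (nat \<lfloor>s\<rfloor>)))"
      using q by (intro step_path_quasi_geodesic) auto
    moreover have "vertex (q (nat \<lfloor>0::real\<rfloor>)) = polygonal_path f 0"
      "vertex (q (nat \<lfloor>real m\<rfloor>)) = polygonal_path f (real ?n)"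
      using q f polygonal_path_of_nat[of f 0] by simp_all
    ultimately have "(\<lambda>s. vertex (q (nat \<lfloor>s\<rfloor>))) ` {0..real m} \<subseteq>
        Cay.neighborhood (\<mu> 1 (real (2 * C) + 1)) (polygonal_path f ` {0..real ?n})"
      using stableD(1)[OF h f(3,1,2)] unfolding Cay.is_morse_def
      by (meson of_nat_0_le_iff order_refl)
    moreover have "vertex p = vertex (q (nat \<lfloor>real (wd \<one> p)\<rfloor>))" "real (wd \<one> p) \<in> {0..real m}"
      using q by (simp_all add: m_def)
    ultimately have "vertex p \<in>
        Cay.neighborhood (\<mu> 1 (real (2 * C) + 1)) (polygonal_path f ` {0..real ?n})" by blast
    then obtain s where s: "0 \<le> s" "s \<le> real ?n"
      and sp: "cayley_dist G A (polygonal_path f s) (vertex p) \<le> real R"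
      using R by (force simp: Cay.neighborhood_def)
    define i where "i = nat \<lfloor>s\<rfloor>"
    have i: "real i \<le> s" "s < real i + 1" using s unfolding i_def by linarith+
    then have "i \<le> ?n" using s by linarith
    have "cayley_dist G A (polygonal_path f (real i)) (polygonal_path f s) \<le> s - real i"
      unfolding cayley_dist_def
      using s i f by (intro graph_dist_le pl_path_polygonal_path[OF f(3)]) auto
    then have "cayley_dist G A (vertex (f i)) (vertex p) \<le> real (R + 1)"
      using sp i Cay.triangle[of "vertex (f i)" "polygonal_path f s" "vertex p"]
        polygonal_path_in_points[OF f(3) _ s] f(1) carr fc[OF \<open>i \<le> ?n\<close>] by simp
    then have ip: "wd (f i) p \<le> R + 1"
      using cayley_dist_wd[of "f i" p] carr fc[OF \<open>i \<le> ?n\<close>] by simp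
    \<comment> \<open>The points \<open>f i\<close> and \<open>p\<close> are close, hence so are their levels \<open>i\<close> and \<open>wd \<one> p\<close>.\<close>
    have "wd \<one> (f i) = i"
      using wd_triangle[of \<one> "f i" h] fw[of 0 i] fw[of i ?n] carr fc[OF \<open>i \<le> ?n\<close>] f \<open>i \<le> ?n\<close>
      by simp
    then have "\<bar>real i - real (wd \<one> p)\<bar> \<le> real (R + 1)"
      using wd_triangle[of \<one> "f i" p] wd_triangle[of \<one> p "f i"] ip wd_sym[of "f i" p]
        carr fc[OF \<open>i \<le> ?n\<close>] by simp
    then have "wd (f i) (f (min (wd \<one> p) ?n)) \<le> R + 1"
      using fw[of i "min (wd \<one> p) ?n"] \<open>i \<le> ?n\<close> by (auto simp: min_def split: if_splits)
    then show ?thesis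
      using ip wd_triangle[of p "f i" "f (min (wd \<one> p) ?n)"] wd_sym[of "f i" p] carr
        fc[OF \<open>i \<le> ?n\<close>] fc[of "min (wd \<one> p) ?n"] by simp
  qed
  note close = this
  have "\<exists>f. f ` {..wd \<one> h} \<subseteq> carrier G \<and>
      (\<forall>i\<le>wd \<one> h. \<forall>j\<le>wd \<one> h. real (wd (f i) (f j)) \<le> \<bar>real i - real j\<bar>) \<and>
      (\<forall>y p. on_geodesic p y \<longrightarrow> wd y h \<le> C \<longrightarrow> wd p (f (min (wd \<one> p) (wd \<one> h))) \<le> 2 * (R + 1))"
    if h: "h \<in> H" for h
  proof -
    obtain f where f: "f 0 = \<one>" "f (wd \<one> h) = h" "\<forall>i<wd \<one> h. (f i, f (Suc i)) \<in> E"
      using geodesic_walk_through[of h h] H_carrier[OF h] by (auto simp: on_geodesic_def)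
    show ?thesis
      using close[OF h f] walk_in_carrier[OF f(3)] wd_walk_le[OF f(3)] f(1)
      by (intro exI[of _ f]) auto
  qed
  then show ?thesis by blast
qed

text \<open>
  Both \<open>g\<close> and the point \<open>p\<close> at the same level of a geodesic to \<open>y\<close> are close to the same
  geodesic to a point of \<open>H\<close> near \<open>x\<close>.
\<close>

lemma nearby_geodesic_passes_close:
  "\<exists>N. \<forall>g x y. x \<in> near_H \<longrightarrow> on_geodesic g x \<longrightarrow> y \<in> carrier G \<longrightarrow> wd x y \<le> D \<longrightarrow>
     (\<exists>p. on_geodesic p y \<and> wd g p \<le> N)"
proof -
  define C where "C = nat \<lceil>k\<rceil> + D"
  obtain r where r: "\<And>h. h \<in> H \<Longrightarrow> \<exists>f. f ` {..wd \<one> h} \<subseteq> carrier G \<and>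
      (\<forall>i\<le>wd \<one> h. \<forall>j\<le>wd \<one> h. real (wd (f i) (f j)) \<le> \<bar>real i - real j\<bar>) \<and>
      (\<forall>y p. on_geodesic p y \<longrightarrow> wd y h \<le> C \<longrightarrow> wd p (f (min (wd \<one> p) (wd \<one> h))) \<le> r)"
    using fellow_traveling[of C] by blast
  have "\<exists>p. on_geodesic p y \<and> wd g p \<le> 2 * r + D"
    if x: "x \<in> near_H" and gx: "on_geodesic g x" and y: "y \<in> carrier G" and xy: "wd x y \<le> D" for g x y
  proof -
    have carr: "g \<in> carrier G" "x \<in> carrier G" using gx by (auto simp: on_geodesic_def)
    obtain h where h: "h \<in> H" "wd x h \<le> nat \<lceil>k\<rceil>" using x by (auto simp: near_H_def)
    let ?n = "wd \<one> h"
    obtain f where fc: "f ` {..?n} \<subseteq> carrier G"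
      and fw: "\<And>i j. i \<le> ?n \<Longrightarrow> j \<le> ?n \<Longrightarrow> real (wd (f i) (f j)) \<le> \<bar>real i - real j\<bar>"
      and close: "\<And>y p. on_geodesic p y \<Longrightarrow> wd y h \<le> C \<Longrightarrow> wd p (f (min (wd \<one> p) ?n)) \<le> r"
      using r[OF h(1)] by blast
    \<comment> \<open>The element \<open>y\<close> can be shorter than \<open>g\<close>, but by at most \<open>D\<close>.\<close>
    define t where "t = min (wd \<one> g) (wd \<one> y)"
    have "t \<le> wd \<one> y" by (simp add: t_def)
    then obtain p where p: "p \<in> carrier G" "wd \<one> p = t" "wd p y = wd \<one> y - t"
      using wd_intermediate[of \<one> y t] y by auto
    then have py: "on_geodesic p y" using y \<open>t \<le> wd \<one> y\<close> by (simp add: on_geodesic_def)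
    have "wd \<one> g \<le> wd \<one> y + D"
      using gx wd_triangle[of \<one> y x] wd_sym[of x y] carr y xy by (simp add: on_geodesic_def)
    then have tg: "\<bar>real (min (wd \<one> g) ?n) - real (min t ?n)\<bar> \<le> real D" by (auto simp: t_def)
    have "wd y h \<le> C"
      using wd_triangle[of y x h] wd_sym[of x y] H_carrier[OF h(1)] carr y xy h(2)
      by (simp add: C_def)
    then have 1: "wd p (f (min t ?n)) \<le> r" using close[OF py] p by simp
    have 2: "wd g (f (min (wd \<one> g) ?n)) \<le> r" using close[OF gx] h(2) by (simp add: C_def)
    have 3: "wd (f (min (wd \<one> g) ?n)) (f (min t ?n)) \<le> D"
      using fw[of "min (wd \<one> g) ?n" "min t ?n"] tg by simp
    have c: "f (min (wd \<one> g) ?n) \<in> carrier G" "f (min t ?n) \<in> carrier G" using fc by auto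
    have "wd g p \<le> 2 * r + D"
      using wd_triangle[of g "f (min (wd \<one> g) ?n)" p]
        wd_triangle[of "f (min (wd \<one> g) ?n)" "f (min t ?n)" p] wd_sym[of p "f (min t ?n)"]
        carr c p(1) 1 2 3 by simp
    then show ?thesis using py by blast
  qed
  then show ?thesis by blast
qed

end

section \<open>A geodesic spanning tree\<close>

context cayley_group
begin

text \<open>
  It is essential that the choice is made from the set of generators that shorten \<open>g\<close>: two elements
  that are shortened by the same generators then get the same letter, whatever the choice is.
\<close>

definition parent_letter :: "'a \<Rightarrow> 'a" where
  "parent_letter g = (SOME a. a \<in> A \<and> Suc (wd \<one> (g \<otimes> a)) = wd \<one> g)"

definition parent :: "'a \<Rightarrow> 'a" where
  "parent g = g \<otimes> parent_letter g"

lemma parent_letter: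
  assumes "g \<in> carrier G" "wd \<one> g = Suc n"
  shows "parent_letter g \<in> A" "wd \<one> (g \<otimes> parent_letter g) = n"
proof -
  obtain p where p: "p \<in> carrier G" "wd \<one> p = n" "wd p g = 1"
    using wd_intermediate[of \<one> g n] assms by auto
  then have "(g, p) \<in> E" using walk_wd[of g p] wd_sym[of g p] assms by simp
  then have "inv g \<otimes> p \<in> A" "g \<otimes> (inv g \<otimes> p) = p"
    using assms p by (auto simp: cayley_edges_def m_assoc[symmetric])
  then have "inv g \<otimes> p \<in> A \<and> Suc (wd \<one> (g \<otimes> (inv g \<otimes> p))) = wd \<one> g"
    using p assms by simp
  then have "parent_letter g \<in> A \<and> Suc (wd \<one> (g \<otimes> parent_letter g)) = wd \<one> g"
    unfolding parent_letter_def by (rule someI)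
  then show "parent_letter g \<in> A" "wd \<one> (g \<otimes> parent_letter g) = n" using assms by auto
qed

lemma parent:
  assumes "g \<in> carrier G" "wd \<one> g = Suc n"
  shows "parent g \<in> carrier G" "wd \<one> (parent g) = n" "wd (parent g) g \<le> 1"
proof -
  note pl = parent_letter[OF assms]
  show "parent g \<in> carrier G" "wd \<one> (parent g) = n"
    using pl A_carrier assms by (auto simp: parent_def)
  then show "wd (parent g) g \<le> 1"
    using wd_mult_generator[OF assms(1) pl(1)] wd_sym[of g "parent g"] assms(1)
    by (simp add: parent_def)
qed

lemma parent_funpow:
  assumes "x \<in> carrier G" "wd \<one> x = m + n"
  shows "(parent ^^ n) x \<in> carrier G \<and> wd \<one> ((parent ^^ n) x) = m \<and> wd ((parent ^^ n) x) x \<le> n"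
  using assms(2)
proof (induction n arbitrary: m)
  case 0
  then show ?case using assms(1) by simp
next
  case (Suc n)
  let ?y = "(parent ^^ n) x"
  have y: "?y \<in> carrier G" "wd \<one> ?y = Suc m" "wd ?y x \<le> n"
    using Suc.IH[of "Suc m"] Suc.prems by auto
  then show ?case using parent[OF y(1,2)] wd_triangle[of "parent ?y" ?y x] assms(1) by simp
qed

definition descendants :: "nat \<Rightarrow> 'a \<Rightarrow> 'a set" where
  "descendants n g = {x \<in> carrier G. wd \<one> x = wd \<one> g + n \<and> (parent ^^ n) x = g}"

lemma finite_descendants: "finite (descendants n g)"
  by (rule finite_subset[OF _ finite_ball[of \<one> "wd \<one> g + n"]]) (auto simp: descendants_def)

lemma descendants_carrier: "descendants n g \<subseteq> carrier G"
  by (auto simp: descendants_def)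

text \<open>
  The descendants are sorted by their ancestor one level below \<open>g\<close>; the set
  \<open>descendants 1 g\<close> consists of the children of \<open>g\<close>.
\<close>

lemma descendants_Suc: "descendants (Suc n) g = (\<Union>y\<in>descendants 1 g. descendants n y)"
proof (intro equalityI subsetI)
  fix x assume x: "x \<in> descendants (Suc n) g"
  then have "(parent ^^ n) x \<in> descendants 1 g" "x \<in> descendants n ((parent ^^ n) x)"
    using parent_funpow[of x "Suc (wd \<one> g)" n] by (auto simp: descendants_def)
  then show "x \<in> (\<Union>y\<in>descendants 1 g. descendants n y)" by blast
qed (auto simp: descendants_def)

lemma descendants_disjoint: "y \<noteq> y' \<Longrightarrow> descendants n y \<inter> descendants n y' = {}"
  by (auto simp: descendants_def)

lemma on_geodesic_descendants:
  assumes "g \<in> carrier G" "x \<in> descendants n g"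
  shows "on_geodesic g x"
  using parent_funpow[of x "wd \<one> g" n] wd_triangle[of \<one> g x] assms
  by (auto simp: descendants_def on_geodesic_def)

lemma descendants_one: "descendants n \<one> = {x \<in> carrier G. wd \<one> x = n}"
proof -
  have "(parent ^^ n) x = \<one>" if "x \<in> carrier G" "wd \<one> x = n" for x
    using parent_funpow[of x 0 n] wd_eq_0[of \<one> "(parent ^^ n) x"] that by simp
  then show ?thesis by (auto simp: descendants_def)
qed

end

section \<open>Finitely many cone types along a stable subgroup\<close>

text \<open>
  The radius \<open>2\<close> suffices for the induction down the tree: whether a generator shortens a neighbor
  of \<open>x\<close> concerns only points at distance at most \<open>2\<close> from \<open>x\<close>.
\<close>

locale stable_cone_types = stable_in_cayley_group +
  fixes N :: nat
  assumes passes_close: "\<lbrakk>x \<in> near_H; on_geodesic g x; y \<in> carrier G; wd x y \<le> 2\<rbrakk> \<Longrightarrow>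
     \<exists>p. on_geodesic p y \<and> wd g p \<le> N"
begin

text \<open>
  Left multiplication by \<open>c\<close> preserves the lengths relative to \<open>g\<close> of the elements of the ball of
  radius \<open>N\<close> around \<open>g\<close>. The equation of differences is written with sums, since subtraction of
  natural numbers is truncated.
\<close>

definition type_preserving :: "'a \<Rightarrow> 'a \<Rightarrow> bool" where
  "type_preserving c g \<longleftrightarrow> c \<in> H \<and> g \<in> carrier G \<and>
     (\<forall>z\<in>carrier G. wd g z \<le> N \<longrightarrow> wd \<one> (c \<otimes> z) + wd \<one> g = wd \<one> z + wd \<one> (c \<otimes> g))"

lemma type_preserving_inv:
  assumes "type_preserving c g"
  shows "type_preserving (inv c) (c \<otimes> g)"
proof -
  have c: "c \<in> H" "c \<in> carrier G" "g \<in> carrier G"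
    using assms H_carrier by (auto simp: type_preserving_def)
  have "wd \<one> (inv c \<otimes> z) + wd \<one> (c \<otimes> g) = wd \<one> z + wd \<one> g"
    if "z \<in> carrier G" "wd (c \<otimes> g) z \<le> N" for z
  proof -
    have "wd g (inv c \<otimes> z) \<le> N"
      using wd_translate[of "c \<otimes> g" z "inv c"] that c by (simp add: inv_mult_cancel)
    then have "wd \<one> (c \<otimes> (inv c \<otimes> z)) + wd \<one> g = wd \<one> (inv c \<otimes> z) + wd \<one> (c \<otimes> g)"
      using assms that c by (simp add: type_preserving_def)
    then show ?thesis using that c by (simp add: inv_mult_cancel)
  qed
  then show ?thesis
    using c subgroup.m_inv_closed[OF subgroup_H] by (simp add: type_preserving_def inv_mult_cancel)
qed

lemma near_H_translate: "c \<in> H \<Longrightarrow> x \<in> near_H \<Longrightarrow> c \<otimes> x \<in> near_H"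
proof -
  assume c: "c \<in> H" and "x \<in> near_H"
  then obtain h where h: "x \<in> carrier G" "h \<in> H" "wd x h \<le> nat \<lceil>k\<rceil>" by (auto simp: near_H_def)
  then have "wd (c \<otimes> x) (c \<otimes> h) \<le> nat \<lceil>k\<rceil>" "c \<otimes> h \<in> H"
    using c H_carrier wd_translate[of x h c] subgroup.m_closed[OF subgroup_H] by auto
  then show "c \<otimes> x \<in> near_H" using h c H_carrier by (auto simp: near_H_def)
qed

text \<open>
  A geodesic to \<open>y\<close> passes through a point \<open>p\<close> of the ball around \<open>g\<close>. Translating its part after \<open>p\<close>
  and using the type at \<open>p\<close> gives a path to \<open>c \<otimes> y\<close> of the required length.
\<close>

lemma type_preserving_length_le:
  assumes st: "type_preserving c g" and x: "x \<in> near_H" "on_geodesic g x"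
    and y: "y \<in> carrier G" "wd x y \<le> 2"
  shows "wd \<one> (c \<otimes> y) + wd \<one> g \<le> wd \<one> y + wd \<one> (c \<otimes> g)"
proof -
  obtain p where p: "on_geodesic p y" "wd g p \<le> N" using passes_close[OF x y] by blast
  then have "p \<in> carrier G" by (simp add: on_geodesic_def)
  moreover have c: "c \<in> carrier G" using st H_carrier by (auto simp: type_preserving_def)
  ultimately have "wd \<one> (c \<otimes> p) + wd \<one> g = wd \<one> p + wd \<one> (c \<otimes> g)"
    using p st by (auto simp: type_preserving_def)
  moreover have "wd \<one> (c \<otimes> y) \<le> wd \<one> (c \<otimes> p) + wd p y"
    using wd_triangle[of \<one> "c \<otimes> p" "c \<otimes> y"] wd_translate[of p y c] c \<open>p \<in> carrier G\<close> y(1) by simp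
  ultimately show ?thesis using p(1) by (simp add: on_geodesic_def)
qed

text \<open>
  The reverse inequality is the previous one for the translation by the inverse of \<open>c\<close>; it is
  applied at the translated points, which requires that \<open>c \<otimes> g\<close> lies on a geodesic to \<open>c \<otimes> x\<close>.
\<close>

lemma type_preserving_length:
  assumes st: "type_preserving c g"
    and x: "x \<in> near_H" "on_geodesic g x" "on_geodesic (c \<otimes> g) (c \<otimes> x)"
    and y: "y \<in> carrier G" "wd x y \<le> 2"
  shows "wd \<one> (c \<otimes> y) + wd \<one> g = wd \<one> y + wd \<one> (c \<otimes> g)"
proof (rule antisym)
  show "wd \<one> (c \<otimes> y) + wd \<one> g \<le> wd \<one> y + wd \<one> (c \<otimes> g)"
    using type_preserving_length_le[OF st x(1,2) y] .
  have c: "c \<in> H" "c \<in> carrier G" using st H_carrier by (auto simp: type_preserving_def)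
  have "x \<in> carrier G" "g \<in> carrier G" using x by (auto simp: on_geodesic_def)
  then show "wd \<one> y + wd \<one> (c \<otimes> g) \<le> wd \<one> (c \<otimes> y) + wd \<one> g"
    using type_preserving_length_le[OF type_preserving_inv[OF st]
        near_H_translate[OF c(1) x(1)] x(3), of "c \<otimes> y"]
      c y wd_translate[of x y c] by (simp add: inv_mult_cancel)
qed

text \<open>
  By induction on the level, the translate of the parent \<open>w\<close> of \<open>x\<close> is a descendant of \<open>c \<otimes> g\<close>, so
  relative lengths are preserved within distance \<open>2\<close> of \<open>w\<close>. This covers \<open>x\<close> and all its
  neighbors, so \<open>x\<close> and \<open>c \<otimes> x\<close> are shortened by the same generators and have the same parent
  letter. The assumption that \<open>x\<close> lies on a geodesic to \<open>H\<close> passes from \<open>x\<close> to \<open>w\<close> and keeps the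
  argument near \<open>H\<close>.
\<close>

lemma descendants_translate:
  assumes st: "type_preserving c g" and h: "h \<in> H" "on_geodesic x h" and x: "x \<in> descendants n g"
  shows "c \<otimes> x \<in> descendants n (c \<otimes> g)"
  using h(2) x
proof (induction n arbitrary: x)
  case 0
  then show ?case using st H_carrier by (auto simp: descendants_def type_preserving_def)
next
  case (Suc n)
  define w where "w = parent x"
  have c: "c \<in> H" "c \<in> carrier G" and g: "g \<in> carrier G"
    using st H_carrier by (auto simp: type_preserving_def)
  have x: "x \<in> carrier G" "wd \<one> x = Suc (wd \<one> g + n)" "(parent ^^ Suc n) x = g"
    using Suc.prems(2) by (auto simp: descendants_def)
  have w: "w \<in> carrier G" "wd \<one> w = wd \<one> g + n" "wd w x \<le> 1"
    using parent[OF x(1,2)] by (auto simp: w_def)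
  have wn: "w \<in> descendants n g"
    using w x(3) by (simp add: descendants_def w_def funpow_swap1)
  have wh: "on_geodesic w h"
    using Suc.prems(1) w x wd_triangle[of w x h] wd_triangle[of \<one> w h] by (simp add: on_geodesic_def)
  have cw: "c \<otimes> w \<in> descendants n (c \<otimes> g)" using Suc.IH[OF wh wn] .
  have len: "wd \<one> (c \<otimes> y) + wd \<one> g = wd \<one> y + wd \<one> (c \<otimes> g)"
    if "y \<in> carrier G" "wd w y \<le> 2" for y
    using type_preserving_length[OF st on_geodesic_near_H[OF h(1) wh] on_geodesic_descendants[OF g wn]
        on_geodesic_descendants[OF _ cw] that] c g by simp
  have lx: "wd \<one> (c \<otimes> x) + wd \<one> g = wd \<one> x + wd \<one> (c \<otimes> g)" using len[of x] x w by simp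
  have "Suc (wd \<one> (c \<otimes> x \<otimes> a)) = wd \<one> (c \<otimes> x) \<longleftrightarrow> Suc (wd \<one> (x \<otimes> a)) = wd \<one> x" if "a \<in> A" for a
  proof -
    have a: "a \<in> carrier G" using A_carrier that by auto
    have "wd w (x \<otimes> a) \<le> 2"
      using wd_triangle[of w x "x \<otimes> a"] wd_mult_generator[OF x(1) that] w x a by simp
    then have "wd \<one> (c \<otimes> (x \<otimes> a)) + wd \<one> g = wd \<one> (x \<otimes> a) + wd \<one> (c \<otimes> g)"
      using len[of "x \<otimes> a"] x a by simp
    then show ?thesis using lx c x a by (simp add: m_assoc) linarith
  qed
  then have "parent_letter (c \<otimes> x) = parent_letter x"
    unfolding parent_letter_def by (intro arg_cong[where f = Eps]) auto
  then have "parent (c \<otimes> x) = c \<otimes> w"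
    using parent_letter(1)[OF x(1,2)] A_carrier c x(1) by (auto simp: parent_def w_def m_assoc)
  then show ?case
    using cw c x lx st by (auto simp: descendants_def funpow_swap1)
qed

text \<open>
  An inequality is enough, since the inverse of a type-preserving translation is type-preserving.
\<close>

lemma card_descendants_le:
  assumes "type_preserving c g"
  shows "card (descendants n g \<inter> H) \<le> card (descendants n (c \<otimes> g) \<inter> H)"
proof (rule card_inj_on_le)
  have c: "c \<in> H" "c \<in> carrier G" using assms H_carrier by (auto simp: type_preserving_def)
  show "inj_on (\<lambda>x. c \<otimes> x) (descendants n g \<inter> H)"
    using c by (auto simp: inj_on_def descendants_def)
  show "(\<lambda>x. c \<otimes> x) ` (descendants n g \<inter> H) \<subseteq> descendants n (c \<otimes> g) \<inter> H"
    using descendants_translate[OF assms] H_carrier c subgroup.m_closed[OF subgroup_H]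
    by (auto simp: on_geodesic_def)
qed (simp add: finite_descendants)

definition descendant_series :: "'a \<Rightarrow> rat fps" where
  "descendant_series g = Abs_fps (\<lambda>n. of_nat (card (descendants n g \<inter> H)))"

lemma descendant_series_translate:
  assumes "type_preserving c g"
  shows "descendant_series (c \<otimes> g) = descendant_series g"
proof -
  have "c \<in> carrier G" "g \<in> carrier G" using assms H_carrier by (auto simp: type_preserving_def)
  then have "card (descendants n (c \<otimes> g) \<inter> H) = card (descendants n g \<inter> H)" for n
    using card_descendants_le[OF assms] card_descendants_le[OF type_preserving_inv[OF assms]]
    by (simp add: inv_mult_cancel le_antisym)
  then show ?thesis by (simp add: descendant_series_def)
qed

text \<open>
  A point above an element of \<open>H\<close> in the tree lies on a geodesic to it, hence near \<open>H\<close>.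
\<close>

lemma descendant_series_eq_0:
  assumes "g \<in> carrier G" "g \<notin> near_H"
  shows "descendant_series g = 0"
proof -
  have "descendants n g \<inter> H = {}" for n
    using on_geodesic_descendants[OF assms(1)] on_geodesic_near_H assms(2) by blast
  then show ?thesis by (simp add: descendant_series_def fps_eq_iff)
qed

lemma fps_shift_descendant_series:
  "fps_shift 1 (descendant_series g) = (\<Sum>y\<in>descendants 1 g. descendant_series y)"
proof (rule fps_ext)
  fix n
  have "descendants (Suc n) g \<inter> H = (\<Union>y\<in>descendants 1 g. descendants n y \<inter> H)"
    by (subst descendants_Suc) blast
  also have "card \<dots> = (\<Sum>y\<in>descendants 1 g. card (descendants n y \<inter> H))"
    by (intro card_UN_disjoint) (use finite_descendants descendants_disjoint in blast)+
  finally show "fps_nth (fps_shift 1 (descendant_series g)) n =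
      fps_nth (\<Sum>y\<in>descendants 1 g. descendant_series y) n"
    by (simp add: descendant_series_def fps_sum_nth)
qed

text \<open>
  The offset stands for the coset \<open>H g\<close>: elements of \<open>near_H\<close> with the same offset differ by
  left multiplication by an element of \<open>H\<close>.
\<close>

definition offset :: "'a \<Rightarrow> 'a" where
  "offset g = (SOME u. u \<in> carrier G \<and> wd \<one> u \<le> nat \<lceil>k\<rceil> \<and> (\<exists>h\<in>H. g = h \<otimes> u))"

lemma offset:
  assumes "g \<in> near_H"
  shows "offset g \<in> carrier G \<and> wd \<one> (offset g) \<le> nat \<lceil>k\<rceil> \<and> (\<exists>h\<in>H. g = h \<otimes> offset g)"
  unfolding offset_def
proof (rule someI_ex)
  obtain h where h: "h \<in> H" "wd g h \<le> nat \<lceil>k\<rceil>" "g \<in> carrier G" "h \<in> carrier G"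
    using assms H_carrier by (auto simp: near_H_def)
  have "wd \<one> (inv h \<otimes> g) = wd g h"
    using wd_translate[of h g "inv h"] wd_sym[of g h] h by simp
  then show "\<exists>u. u \<in> carrier G \<and> wd \<one> u \<le> nat \<lceil>k\<rceil> \<and> (\<exists>h\<in>H. g = h \<otimes> u)"
    using h inv_mult_cancel(2)[of h g] by (intro exI[of _ "inv h \<otimes> g"]) force
qed

definition cone_type :: "'a \<Rightarrow> ('a \<Rightarrow> int) \<times> 'a" where
  "cone_type g =
     (\<lambda>z\<in>{z \<in> carrier G. wd \<one> z \<le> N}. int (wd \<one> (g \<otimes> z)) - int (wd \<one> g), offset g)"

lemma finite_cone_types: "finite (cone_type ` near_H)"
proof (rule finite_subset)
  let ?B = "\<lambda>n. {z \<in> carrier G. wd \<one> z \<le> n}"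
  show "finite ((\<Pi>\<^sub>E z\<in>?B N. {- int N..int N}) \<times> ?B (nat \<lceil>k\<rceil>))"
    by (intro finite_cartesian_product finite_PiE finite_ball) auto
  have diff: "int (wd \<one> (g \<otimes> z)) - int (wd \<one> g) \<in> {- int N..int N}"
    if "g \<in> carrier G" "z \<in> ?B N" for g z
    using wd_triangle[of \<one> g "g \<otimes> z"] wd_triangle[of \<one> "g \<otimes> z" g] wd_sym[of g "g \<otimes> z"]
      wd_translate[of \<one> z g] that by simp
  show "cone_type ` near_H \<subseteq> (\<Pi>\<^sub>E z\<in>?B N. {- int N..int N}) \<times> ?B (nat \<lceil>k\<rceil>)"
  proof (rule image_subsetI)
    fix g assume g: "g \<in> near_H"
    then have "g \<in> carrier G" by (simp add: near_H_def)
    then show "cone_type g \<in> (\<Pi>\<^sub>E z\<in>?B N. {- int N..int N}) \<times> ?B (nat \<lceil>k\<rceil>)"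
      unfolding cone_type_def using offset[OF g] diff
      by (intro SigmaI restrict_PiE_iff[THEN iffD2] ballI) simp_all
  qed
qed

lemma descendant_series_cong_cone_type:
  assumes g: "g \<in> near_H" and g': "g' \<in> near_H" and eq: "cone_type g = cone_type g'"
  shows "descendant_series g = descendant_series g'"
proof -
  obtain h h' u where h: "h \<in> H" "h' \<in> H" "u \<in> carrier G" "g = h \<otimes> u" "g' = h' \<otimes> u"
    using offset[OF g] offset[OF g'] eq by (auto simp: cone_type_def)
  define c where "c = h' \<otimes> inv h"
  have hc: "h \<in> carrier G" "h' \<in> carrier G" using h H_carrier by auto
  have c: "c \<in> H" "c \<in> carrier G"
    using h hc subgroup.m_closed[OF subgroup_H] subgroup.m_inv_closed[OF subgroup_H]
    by (auto simp: c_def)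
  have gc: "g \<in> carrier G" "g' \<in> carrier G" using h hc by auto
  have cg: "c \<otimes> g = g'" using h hc by (simp add: c_def m_assoc inv_mult_cancel)
  have "wd \<one> (c \<otimes> z) + wd \<one> g = wd \<one> z + wd \<one> g'" if z: "z \<in> carrier G" "wd g z \<le> N" for z
  proof -
    let ?v = "inv g \<otimes> z"
    have v: "?v \<in> {v \<in> carrier G. wd \<one> v \<le> N}"
      using wd_translate[of g z "inv g"] z gc by simp
    have "fst (cone_type g) ?v = fst (cone_type g') ?v" using eq by simp
    then have "int (wd \<one> (g \<otimes> ?v)) - int (wd \<one> g) = int (wd \<one> (g' \<otimes> ?v)) - int (wd \<one> g')"
      using v by (simp add: cone_type_def)
    moreover have "g \<otimes> ?v = z" using gc z by (simp add: inv_mult_cancel)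
    moreover from this have "g' \<otimes> ?v = c \<otimes> z" using gc z c cg m_assoc[of c g ?v] by simp
    ultimately show ?thesis by simp
  qed
  then have "type_preserving c g" using c gc cg by (simp add: type_preserving_def)
  from descendant_series_translate[OF this] show ?thesis by (simp add: cg)
qed

lemma finite_descendant_series: "finite (descendant_series ` carrier G)"
proof -
  have "descendant_series ` near_H \<subseteq>
      (\<lambda>t. descendant_series (inv_into near_H cone_type t)) ` (cone_type ` near_H)"
  proof clarify
    fix g assume g: "g \<in> near_H"
    have "descendant_series g = descendant_series (inv_into near_H cone_type (cone_type g))"
      using g by (intro descendant_series_cong_cone_type) (auto simp: inv_into_into f_inv_into_f)
    then show "descendant_series g \<in>
        (\<lambda>t. descendant_series (inv_into near_H cone_type t)) ` (cone_type ` near_H)"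
      using g by blast
  qed
  then have "finite (descendant_series ` near_H)" using finite_cone_types finite_surj by blast
  moreover have "descendant_series ` carrier G \<subseteq> insert 0 (descendant_series ` near_H)"
    using descendant_series_eq_0 by auto
  ultimately show ?thesis using finite_subset by blast
qed

lemma descendant_series_one_rational:
  "\<exists>P Q. coeff Q 0 \<noteq> 0 \<and> descendant_series \<one> * fps_of_poly Q = fps_of_poly P"
proof (rule finite_shift_family_rational[OF finite_descendant_series])
  fix F assume "F \<in> descendant_series ` carrier G"
  then obtain g where "F = descendant_series g" by blast
  then show "\<exists>I c. finite I \<and> c ` I \<subseteq> descendant_series ` carrier G \<and>
      fps_shift 1 F = (\<Sum>i\<in>(I :: 'a set). c i)"
    using fps_shift_descendant_series[of g] finite_descendants descendants_carrier[of 1 g]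
    by (intro exI[of _ "descendants 1 g"] exI[of _ descendant_series]) auto
qed simp

text \<open>
  The balls of \<open>H\<close> are the partial sums of its spheres, and the descendants of the identity at
  level \<open>n\<close> form the sphere of radius \<open>n\<close>.
\<close>

lemma growth_series:
  "Abs_fps (\<lambda>n. of_nat (growth_function G H A n)) * (1 - fps_X) = descendant_series \<one>"
proof (rule fps_ext)
  fix n
  let ?B = "\<lambda>n. {h \<in> H. wd \<one> h \<le> n}"
  have growth: "growth_function G H A n = card (?B n)" for n
    unfolding growth_function_def using cayley_dist_wd[of \<one>] H_carrier
    by (intro arg_cong[where f = card]) auto
  have fin: "finite (?B n)" for n
    by (rule finite_subset[OF _ finite_ball[of \<one> n]]) (use H_carrier in auto)
  show "fps_nth (Abs_fps (\<lambda>n. of_nat (growth_function G H A n)) * (1 - fps_X)) n =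
      fps_nth (descendant_series \<one>) n"
  proof (cases n)
    case 0
    have "?B 0 = descendants 0 \<one> \<inter> H" using H_carrier by (auto simp: descendants_one)
    then show ?thesis using 0 by (simp add: descendant_series_def growth)
  next
    case (Suc m)
    have "?B (Suc m) = ?B m \<union> (descendants (Suc m) \<one> \<inter> H)"
      using H_carrier by (auto simp: descendants_one)
    also have "card \<dots> = card (?B m) + card (descendants (Suc m) \<one> \<inter> H)"
      using fin finite_descendants[of "Suc m" \<one>]
      by (intro card_Un_disjoint) (auto simp: descendants_one)
    finally show ?thesis using Suc by (simp add: descendant_series_def growth algebra_simps)
  qed
qed

end

theorem corollary6:
  fixes G :: "('a, 'b) monoid_scheme" and H A :: "'a set"
  assumes "morse_local_to_global_group G"
    and "stable_subgroup H G"
    and "finite_generating_set G A"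
  shows "\<exists>P Q :: rat poly. coeff Q 0 \<noteq> 0 \<and>
           Abs_fps (\<lambda>n. of_nat (growth_function G H A n)) = fps_of_poly P / fps_of_poly Q"
proof -
  have "group G" using assms(1) by (simp add: morse_local_to_global_group_def)
  moreover obtain \<mu> k where "stable_in_cayley G A \<mu> k H"
    using assms(2,3) by (auto simp: stable_subgroup_def)
  moreover have "subgroup H G" using assms(2) by (simp add: stable_subgroup_def)
  ultimately interpret stable_in_cayley_group G A H \<mu> k
    using assms(3)
    by (simp add: stable_in_cayley_group_def stable_in_cayley_group_axioms_def
        cayley_group_def cayley_group_axioms_def)
  obtain N where N: "\<forall>g x y. x \<in> near_H \<longrightarrow> on_geodesic g x \<longrightarrow> y \<in> carrier G \<longrightarrow> wd x y \<le> 2 \<longrightarrow>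
     (\<exists>p. on_geodesic p y \<and> wd g p \<le> N)"
    using nearby_geodesic_passes_close by blast
  interpret stable_cone_types G A H \<mu> k N
    by unfold_locales (use N in blast)
  obtain P Q where Q: "coeff Q 0 \<noteq> 0" and PQ: "descendant_series \<one>\<^bsub>G\<^esub> * fps_of_poly Q = fps_of_poly P"
    using descendant_series_one_rational by blast
  let ?f = "Abs_fps (\<lambda>n. of_nat (growth_function G H A n)) :: rat fps"
  let ?D = "[:1, -1:] * Q"
  have D: "fps_of_poly ?D = (1 - fps_X) * fps_of_poly Q"
    by (simp add: fps_of_poly_mult fps_of_poly_pCons)
  have 0: "coeff ?D 0 \<noteq> 0" using Q by (simp add: coeff_mult_0)
  have "?f * fps_of_poly ?D = fps_of_poly P"
    using PQ by (simp only: D growth_series flip: mult.assoc)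
  moreover have "fps_of_poly ?D \<noteq> 0"
    using 0 fps_of_poly_nth[of ?D 0] by (metis fps_zero_nth)
  ultimately have "?f = fps_of_poly P / fps_of_poly ?D"
    by (metis nonzero_mult_div_cancel_right)
  then show ?thesis using 0 by blast
qed

end
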